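(* Let $\mathcal{G}$ be a closed class of connected, locally finite graphs. The following three statements are equivalent. (1) There is a connected, locally finite graph $H$ which strongly contains $\mathcal{G}$. (2) There is a connected, locally finite graph $H$ which contains $\mathcal{G}$. (3) The tree $T(\mathcal{G})$ does not contain a subdivision of $T_\infty$.
   Context: All graphs are simple, connected (in particular nonempty) and countable. A graph is locally finite if all its vertices have finite degree. A graph class is a class of graphs closed under isomorphism. A graph $H$ contains $\mathcal{G}$ if every $G\in\mathcal{G}$ is isomorphic to a subgraph of $H$, and strongly contains $\mathcal{G}$ if every $G\in\mathcal{G}$ is isomorphic to an induced subgraph of $H$. Write $\mathbb{N}=\{1,2,\dots\}$ and $\mathbb{N}_0=\mathbb{N}\cup\{0\}$. For a graph $G$, $v\in V(G)$ and $r\in\mathbb{N}_0$, $B_G(v,r)$ is the ball of radius $r$ and centre $v$ in $G$, i.e. the subgraph induced by the vertices at distance at most $r$ from $v$, with distinguished vertex $v$. Let $\mathcal{B}=\{B_G(v,r)\mid G\in\mathcal{G},\ v\in V(G),\ r\in\mathbb{N}_0\}$, where $B_G(v,r)$ and $B_{G'}(v',r)$ (same $r$) are considered the same if there is an isomorphism between them mapping $v$ to $v'$; balls with different radii are always considered different elements, even if they are isomorphic. $T(\mathcal{G})$ is the tree with vertex set $\mathcal{B}$ in which $B_G(v,r-1)$ and $B_G(v,r)$ are connected by an edge for every $G\in\mathcal{G}$, $v\in V(G)$ and $r\in\mathbb{N}$. $\mathcal{G}$ is closed if for every graph $G\notin\mathcal{G}$ there are $v\in V(G)$ and $r\in\mathbb{N}$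 such that $B_G(v,r)\notin\mathcal{B}$. $T_\infty$ denotes the tree in which every vertex has countably infinite degree. *)

theory Defs
  imports Main "HOL-Library.Countable_Set" "HOL-Library.Nat_Bijection"
begin

section \<open>Graphs\<close>

record 'a sgraph =
  vertices :: "'a set"
  edges :: "'a set set"

definition simple_graph :: "'a sgraph \<Rightarrow> bool" where
  "simple_graph G \<longleftrightarrow>
    (\<forall>e\<in>edges G. \<exists>u\<in>vertices G. \<exists>v\<in>vertices G. u \<noteq> v \<and> e = {u, v})"

definition walk :: "'a sgraph \<Rightarrow> 'a list \<Rightarrow> bool" where
  "walk G xs \<longleftrightarrow> xs \<noteq> [] \<and> set xs \<subseteq> vertices G \<and> successively (\<lambda>u v. {u, v} \<in> edges G) xs"

definition graph_connected :: "'a sgraph \<Rightarrow> bool" where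
  "graph_connected G \<longleftrightarrow> vertices G \<noteq> {} \<and>
    (\<forall>u\<in>vertices G. \<forall>v\<in>vertices G. \<exists>xs. walk G xs \<and> hd xs = u \<and> last xs = v)"

definition is_graph :: "'a sgraph \<Rightarrow> bool" where
  "is_graph G \<longleftrightarrow> simple_graph G \<and> graph_connected G \<and> countable (vertices G)"

definition neighbours :: "'a sgraph \<Rightarrow> 'a \<Rightarrow> 'a set" where
  "neighbours G v = {u. {v, u} \<in> edges G}"

definition locally_finite :: "'a sgraph \<Rightarrow> bool" where
  "locally_finite G \<longleftrightarrow> (\<forall>v\<in>vertices G. finite (neighbours G v))"

definition graph_iso :: "('a \<Rightarrow> 'b) \<Rightarrow> 'a sgraph \<Rightarrow> 'b sgraph \<Rightarrow> bool" where
  "graph_iso f G H \<longleftrightarrow> bij_betw f (vertices G) (vertices H) \<and>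
    (\<forall>u\<in>vertices G. \<forall>v\<in>vertices G. {u, v} \<in> edges G \<longleftrightarrow> {f u, f v} \<in> edges H)"

definition isomorphic :: "'a sgraph \<Rightarrow> 'b sgraph \<Rightarrow> bool" where
  "isomorphic G H \<longleftrightarrow> (\<exists>f. graph_iso f G H)"

definition is_subgraph :: "'a sgraph \<Rightarrow> 'a sgraph \<Rightarrow> bool" where
  "is_subgraph K G \<longleftrightarrow> simple_graph K \<and> vertices K \<subseteq> vertices G \<and> edges K \<subseteq> edges G"

definition induced_on :: "'a sgraph \<Rightarrow> 'a set \<Rightarrow> 'a sgraph" where
  "induced_on G S = \<lparr>vertices = S, edges = {e \<in> edges G. e \<subseteq> S}\<rparr>"

definition contains :: "'b sgraph \<Rightarrow> 'a sgraph set \<Rightarrow> bool" where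
  "contains H \<G> \<longleftrightarrow> (\<forall>G\<in>\<G>. \<exists>K. is_subgraph K H \<and> isomorphic G K)"

definition strongly_contains :: "'b sgraph \<Rightarrow> 'a sgraph set \<Rightarrow> bool" where
  "strongly_contains H \<G> \<longleftrightarrow>
    (\<forall>G\<in>\<G>. \<exists>S\<subseteq>vertices H. isomorphic G (induced_on H S))"

section \<open>Graph classes and their balls\<close>

text \<open>Every countable graph is isomorphic to one whose vertices are natural numbers, so a class
  of countable graphs closed under isomorphism is the same thing as a set of graphs on
  subsets of \<^typ>\<open>nat\<close> closed under isomorphism between such graphs.\<close>

definition graph_class :: "nat sgraph set \<Rightarrow> bool" where
  "graph_class \<G> \<longleftrightarrow> (\<forall>G\<in>\<G>. is_graph G) \<and>
    (\<forall>G\<in>\<G>. \<forall>G'. is_graph G' \<and> isomorphic G G' \<longrightarrow> G' \<in> \<G>)"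

text \<open>The \<open>LEAST\<close> is over a nonempty set whenever the graph is connected and \<open>u\<close>, \<open>v\<close>
  are vertices of it; the distance is only used in that situation.\<close>

definition graph_dist :: "'a sgraph \<Rightarrow> 'a \<Rightarrow> 'a \<Rightarrow> nat" where
  "graph_dist G u v =
    (LEAST n. \<exists>xs. walk G xs \<and> hd xs = u \<and> last xs = v \<and> length xs = Suc n)"

definition graph_ball :: "'a sgraph \<Rightarrow> 'a \<Rightarrow> nat \<Rightarrow> 'a sgraph" where
  "graph_ball G v r = induced_on G {u \<in> vertices G. graph_dist G v u \<le> r}"

definition rooted_isomorphic :: "'a sgraph \<Rightarrow> 'a \<Rightarrow> 'b sgraph \<Rightarrow> 'b \<Rightarrow> bool" where
  "rooted_isomorphic G v H w \<longleftrightarrow>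
    v \<in> vertices G \<and> w \<in> vertices H \<and> (\<exists>f. graph_iso f G H \<and> f v = w)"

text \<open>A ball up to root-preserving isomorphism, as an element of the vertex set of the tree of
  balls: the radius together with the isomorphism class of the rooted graph. Keeping the radius
  separates isomorphic balls of different radii.\<close>

definition ball_type :: "nat sgraph \<Rightarrow> nat \<Rightarrow> nat \<Rightarrow> nat \<times> (nat sgraph \<times> nat) set" where
  "ball_type G v r =
    (r, {(K, w). simple_graph K \<and> rooted_isomorphic (graph_ball G v r) v K w})"

definition ball_types :: "nat sgraph set \<Rightarrow> (nat \<times> (nat sgraph \<times> nat) set) set" where
  "ball_types \<G> = {ball_type G v r | G v r. G \<in> \<G> \<and> v \<in> vertices G}"

definition ball_tree :: "nat sgraph set \<Rightarrow> (nat \<times> (nat sgraph \<times> nat) set) sgraph" where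
  "ball_tree \<G> =
    \<lparr>vertices = ball_types \<G>,
     edges = {{ball_type G v (r - 1), ball_type G v r} | G v r.
                G \<in> \<G> \<and> v \<in> vertices G \<and> r \<ge> 1}\<rparr>"

definition closed_class :: "nat sgraph set \<Rightarrow> bool" where
  "closed_class \<G> \<longleftrightarrow>
    (\<forall>G. is_graph G \<and> G \<notin> \<G> \<longrightarrow>
      (\<exists>v\<in>vertices G. \<exists>r\<ge>1. ball_type G v r \<notin> ball_types \<G>))"

section \<open>Subdivisions and the infinitely branching tree\<close>

definition graph_path :: "'a sgraph \<Rightarrow> 'a list \<Rightarrow> bool" where
  "graph_path G xs \<longleftrightarrow> walk G xs \<and> distinct xs"

definition path_edges :: "'a list \<Rightarrow> 'a set set" where
  "path_edges xs = {{xs ! i, xs ! Suc i} | i. Suc i < length xs}"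

definition inner_vertices :: "'a list \<Rightarrow> 'a set" where
  "inner_vertices xs = set (butlast (tl xs))"

text \<open>\<open>\<phi>\<close> gives the branch vertices and \<open>P x y\<close> is the path replacing the edge \<open>{x, y}\<close>,
  traversed from \<open>\<phi> x\<close> to \<open>\<phi> y\<close>. A path may consist of a single edge.\<close>

definition is_subdivision :: "'b sgraph \<Rightarrow> 'a sgraph \<Rightarrow> bool" where
  "is_subdivision S X \<longleftrightarrow>
    (\<exists>\<phi> P.
      inj_on \<phi> (vertices X) \<and>
      (\<forall>x y. {x, y} \<in> edges X \<longrightarrow>
        graph_path S (P x y) \<and> hd (P x y) = \<phi> x \<and> last (P x y) = \<phi> y \<and>
        P y x = rev (P x y) \<and>
        inner_vertices (P x y) \<inter> \<phi> ` vertices X = {}) \<and>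
      (\<forall>x y x' y'. {x, y} \<in> edges X \<and> {x', y'} \<in> edges X \<and> {x, y} \<noteq> {x', y'} \<longrightarrow>
        inner_vertices (P x y) \<inter> inner_vertices (P x' y') = {}) \<and>
      vertices S = \<phi> ` vertices X \<union> \<Union>{inner_vertices (P x y) | x y. {x, y} \<in> edges X} \<and>
      edges S = \<Union>{path_edges (P x y) | x y. {x, y} \<in> edges X})"

definition contains_subdivision :: "'b sgraph \<Rightarrow> 'a sgraph \<Rightarrow> bool" where
  "contains_subdivision G X \<longleftrightarrow> (\<exists>S. is_subgraph S G \<and> is_subdivision S X)"

definition is_cycle :: "'a sgraph \<Rightarrow> 'a list \<Rightarrow> bool" where
  "is_cycle G xs \<longleftrightarrow> graph_path G xs \<and> length xs \<ge> 3 \<and> {last xs, hd xs} \<in> edges G"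

definition is_tree :: "'a sgraph \<Rightarrow> bool" where
  "is_tree G \<longleftrightarrow> is_graph G \<and> (\<nexists>xs. is_cycle G xs)"

text \<open>This determines the graph up to isomorphism; \<open>is_T_infinity_exists\<close> below provides a copy
  on the natural numbers.\<close>

definition is_T_infinity :: "'a sgraph \<Rightarrow> bool" where
  "is_T_infinity T \<longleftrightarrow> is_tree T \<and>
    (\<forall>v\<in>vertices T. countable (neighbours T v) \<and> infinite (neighbours T v))"

section \<open>Sanity checks\<close>

lemma graph_iso_inv:
  assumes "graph_iso f G H"
  shows "graph_iso (inv_into (vertices G) f) H G"
proof -
  let ?g = "inv_into (vertices G) f"
  have f: "bij_betw f (vertices G) (vertices H)" using assms by (simp add: graph_iso_def)
  have g: "bij_betw ?g (vertices H) (vertices G)" by (rule bij_betw_inv_into[OF f])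
  have "{x, y} \<in> edges H \<longleftrightarrow> {?g x, ?g y} \<in> edges G"
    if "x \<in> vertices H" "y \<in> vertices H" for x y
    using assms bij_betw_apply[OF g that(1)] bij_betw_apply[OF g that(2)]
      bij_betw_inv_into_right[OF f that(1)] bij_betw_inv_into_right[OF f that(2)]
    by (simp add: graph_iso_def)
  thus ?thesis using g by (simp add: graph_iso_def)
qed

lemma graph_iso_comp:
  assumes "graph_iso f G H" "graph_iso g H K"
  shows "graph_iso (g \<circ> f) G K"
proof -
  have "f u \<in> vertices H" if "u \<in> vertices G" for u
    using assms(1) that by (auto simp: graph_iso_def dest: bij_betw_apply)
  moreover have "bij_betw (g \<circ> f) (vertices G) (vertices K)"
    using assms by (blast intro: bij_betw_trans dest: graph_iso_def[THEN iffD1])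
  ultimately show ?thesis using assms by (simp add: graph_iso_def)
qed

lemma rooted_isomorphic_sym:
  "rooted_isomorphic G v H w \<Longrightarrow> rooted_isomorphic H w G v"
proof -
  assume a: "rooted_isomorphic G v H w"
  then obtain f where f: "graph_iso f G H" "f v = w" and v: "v \<in> vertices G"
    by (auto simp: rooted_isomorphic_def)
  have "inv_into (vertices G) f w = v"
    using f v by (auto simp: graph_iso_def bij_betw_def)
  thus ?thesis using a graph_iso_inv[OF f(1)] by (auto simp: rooted_isomorphic_def)
qed

lemma rooted_isomorphic_trans:
  "rooted_isomorphic G v H w \<Longrightarrow> rooted_isomorphic H w K x \<Longrightarrow> rooted_isomorphic G v K x"
  unfolding rooted_isomorphic_def by (metis graph_iso_comp comp_apply)

lemma ball_type_eq_iff: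
  assumes "simple_graph G" "v \<in> vertices G"
  shows "ball_type G v r = ball_type G' v' r' \<longleftrightarrow>
    r = r' \<and> rooted_isomorphic (graph_ball G v r) v (graph_ball G' v' r') v'"
proof -
  have "walk G [v]" using assms(2) by (simp add: walk_def)
  hence "graph_dist G v v = 0"
    unfolding graph_dist_def by (intro Least_eq_0) (auto intro: exI[of _ "[v]"])
  hence v: "v \<in> vertices (graph_ball G v r)"
    using assms(2) by (simp add: graph_ball_def induced_on_def)
  have s: "simple_graph (graph_ball G v r)"
    using assms(1) by (fastforce simp: simple_graph_def graph_ball_def induced_on_def)
  have refl: "rooted_isomorphic (graph_ball G v r) v (graph_ball G v r) v"
    using v by (auto simp: rooted_isomorphic_def graph_iso_def intro: exI[of _ id])
  show ?thesis
  proof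
    assume eq: "ball_type G v r = ball_type G' v' r'"
    have "(graph_ball G v r, v) \<in> snd (ball_type G v r)"
      using s refl by (simp add: ball_type_def)
    hence "(graph_ball G v r, v) \<in> snd (ball_type G' v' r')" by (simp only: eq)
    hence "rooted_isomorphic (graph_ball G' v' r') v' (graph_ball G v r) v"
      by (simp add: ball_type_def)
    moreover have "r = r'" using eq by (simp add: ball_type_def)
    ultimately show "r = r' \<and> rooted_isomorphic (graph_ball G v r) v (graph_ball G' v' r') v'"
      using rooted_isomorphic_sym by simp
  next
    assume iso: "r = r' \<and> rooted_isomorphic (graph_ball G v r) v (graph_ball G' v' r') v'"
    hence "rooted_isomorphic (graph_ball G v r) v K w \<longleftrightarrow>
        rooted_isomorphic (graph_ball G' v' r') v' K w" for K :: "nat sgraph" and w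
      using rooted_isomorphic_sym[of "graph_ball G v r" v "graph_ball G' v' r'" v']
        rooted_isomorphic_trans[of "graph_ball G v r" v "graph_ball G' v' r'" v' K w]
        rooted_isomorphic_trans[of "graph_ball G' v' r'" v' "graph_ball G v r" v K w]
      by blast
    thus "ball_type G v r = ball_type G' v' r'" using iso by (simp add: ball_type_def)
  qed
qed

lemma is_T_infinity_exists: "\<exists>T :: nat sgraph. is_T_infinity T"
proof -
  define p where "p m = fst (prod_decode m)" for m
  define T :: "nat sgraph" where
    "T = \<lparr>vertices = UNIV, edges = {{p m, Suc m} | m. True}\<rparr>"
  have p: "p m \<le> m" for m
    by (metis p_def fst_conv le_prod_encode_1 prod.collapse prod_decode_inverse)
  have V: "vertices T = UNIV" by (simp add: T_def)
  have E: "{x, y} \<in> edges T \<longleftrightarrow> (\<exists>m. (x = p m \<and> y = Suc m) \<or> (y = p m \<and> x = Suc m))" for x y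
    by (auto simp: T_def doubleton_eq_iff)
  have parent: "x = y" if "{z, x} \<in> edges T" "{z, y} \<in> edges T" "x \<le> z" "y \<le> z" for x y z
  proof -
    have *: "\<exists>m. z = Suc m \<and> w = p m" if "{z, w} \<in> edges T" "w \<le> z" for w
    proof -
      from that(1) obtain m where "(z = p m \<and> w = Suc m) \<or> (w = p m \<and> z = Suc m)"
        unfolding E by blast
      thus ?thesis using that(2) p[of m] by auto
    qed
    show ?thesis using *[of x] *[of y] that by auto
  qed
  have "simple_graph T"
    unfolding simple_graph_def
  proof
    fix e assume "e \<in> edges T"
    then obtain m where "e = {p m, Suc m}" by (auto simp: T_def)
    moreover have "p m \<noteq> Suc m" using p[of m] by simp
    ultimately show "\<exists>u\<in>vertices T. \<exists>v\<in>vertices T. u \<noteq> v \<and> e = {u, v}"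
      unfolding V by blast
  qed
  moreover have "graph_connected T"
  proof -
    have up: "\<exists>xs. walk T xs \<and> hd xs = 0 \<and> last xs = n" for n
    proof (induction n rule: less_induct)
      case (less n)
      show ?case
      proof (cases n)
        case 0
        thus ?thesis by (intro exI[of _ "[0]"]) (simp add: walk_def V)
      next
        case (Suc m)
        then obtain xs where "walk T xs" "hd xs = 0" "last xs = p m"
          using less p by (metis le_imp_less_Suc)
        thus ?thesis using Suc
          by (intro exI[of _ "xs @ [n]"]) (auto simp: walk_def V successively_append_iff E)
      qed
    qed
    have "\<exists>xs. walk T xs \<and> hd xs = u \<and> last xs = v" for u v
    proof -
      obtain xs ys where xs: "walk T xs" "hd xs = 0" "last xs = u"
        and ys: "walk T ys" "hd ys = 0" "last ys = v" using up by meson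
      from ys obtain zs where z: "ys = 0 # zs" by (cases ys) (auto simp: walk_def)
      have "walk T (rev xs @ zs)" using xs ys z
        by (cases zs) (auto simp: walk_def V successively_append_iff insert_commute last_rev)
      moreover have "hd (rev xs @ zs) = u" "last (rev xs @ zs) = v"
        using xs ys z by (auto simp: walk_def hd_rev last_rev)
      ultimately show ?thesis by blast
    qed
    thus ?thesis by (simp add: graph_connected_def V)
  qed
  moreover have "\<not> is_cycle T xs" for xs
  proof
    assume c: "is_cycle T xs"
    define n where "n = length xs"
    have n: "n \<ge> 3" and d: "distinct xs" using c by (auto simp: is_cycle_def graph_path_def n_def)
    have step: "{xs ! i, xs ! (Suc i mod n)} \<in> edges T" if "i < n" for i
    proof (cases "Suc i < n")
      case True
      thus ?thesis using c by (auto simp: is_cycle_def graph_path_def walk_def n_def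
            successively_conv_nth)
    next
      case False
      hence Si: "Suc i = n" using that by simp
      have "xs \<noteq> []" using n by (auto simp: n_def)
      hence "last xs = xs ! i" "hd xs = xs ! 0"
        using Si by (simp_all add: last_conv_nth hd_conv_nth n_def[symmetric] flip: Si)
      thus ?thesis using c Si by (simp add: is_cycle_def)
    qed
    have "Max (set xs) \<in> set xs" using n by (intro Max_in) (auto simp: n_def)
    then obtain i where i: "i < n" "xs ! i = Max (set xs)" by (auto simp: in_set_conv_nth n_def)
    have le: "xs ! j \<le> xs ! i" if "j < n" for j using that i by (simp add: n_def)
    define k where "k = (if i = 0 then n - 1 else i - 1)"
    define j where "j = Suc i mod n"
    have j: "j = (if Suc i = n then 0 else Suc i)" using i by (simp add: j_def mod_Suc)
    have k: "k < n" "Suc k mod n = i" using i n by (auto simp: k_def)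
    have jk: "j < n" "j \<noteq> k" using i n by (auto simp: j k_def)
    have "xs ! j = xs ! k"
      using step[OF i(1)] step[OF k(1)] le jk k
      by (intro parent[of "xs ! i"]) (auto simp: j_def insert_commute)
    thus False using d jk k by (simp add: nth_eq_iff_index_eq n_def)
  qed
  moreover have "infinite (neighbours T v)" for v
  proof -
    have "range (\<lambda>k. Suc (prod_encode (v, k))) \<subseteq> neighbours T v"
      by (auto simp: neighbours_def E p_def) (metis fst_conv prod_encode_inverse)
    moreover have "infinite (range (\<lambda>k. Suc (prod_encode (v, k))))"
      by (intro range_inj_infinite) (auto intro!: injI)
    ultimately show ?thesis using infinite_super by blast
  qed
  ultimately have "is_T_infinity T"
    by (auto simp: is_T_infinity_def is_tree_def is_graph_def)
  thus ?thesis by blast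
qed

end

theory Submission
  imports Defs
begin

text \<open>
  Call a set \<open>U\<close> of balls branching if every \<open>u \<in> U\<close> has infinitely many children in the tree
  of balls below which \<open>U\<close> continues; the tree contains a subdivision of \<open>T\<^sub>\<infinity>\<close> iff there is a
  nonempty branching set.

  Suppose \<open>U\<close> is branching and \<open>H\<close> is a locally finite graph with vertices \<open>h\<^sub>0, h\<^sub>1, \<dots>\<close>. Only
  finitely many balls of a given radius embed into \<open>H\<close> with centre \<open>h\<^sub>n\<close>, so one can climb the tree
  through \<open>U\<close>, choosing in the \<open>n\<close>-th step a ball that does not embed with centre \<open>h\<^sub>n\<close>. As the class
  is closed, the ray so obtained consists of the balls of a member of the class, which therefore is
  not contained in \<open>H\<close>.

  Conversely, call a ball bad if the members of the class in which it occurs do not embed as induced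
  subgraphs into one countable locally finite graph. If every descendant of a ball \<open>u\<close> has finitely
  many bad children, then \<open>u\<close> is not bad: a graph containing \<open>u\<close> either contains one of the
  countably many good descendants of \<open>u\<close>, or its ray stays in a locally finite subtree, and all
  graphs of the latter kind embed into the direct limit of the balls of that subtree. Hence if the
  balls of radius 0 are bad, the balls with infinitely many bad children form a branching set.
\<close>

text \<open>The tree knows balls only up to isomorphism, and an isomorphism between two balls need
  not extend to larger ones, so a ray of the tree does not by itself give compatible graphs. The
  remedy is to number the vertices of each graph so that all balls about the root 0 are initial
  segments of the natural numbers, and to extend a numbering of a ball without changing it.
  Consecutive balls of a ray can then be taken literally nested and limits become unions. Moreover,
  each ball type has only finitely many numbered representatives, which keeps the direct limit
  locally finite.

  Badness takes the place of a transfinite rank measuring how deeply infinite branching is nested: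
  it refers to the graphs themselves and needs no ordinals. Passing to an ancestor means combining
  countably many hosts, so hosts may be disconnected until the very end, which makes disjoint unions
  available. Branching sets stand in for subdivisions because they name the branch vertices only;
  the paths between these are forced in a tree.\<close>

section \<open>Balls as iterated neighbourhoods\<close>

text \<open>The vertex set of a ball by recursion on the radius, instead of the \<open>LEAST\<close>
  in \<open>graph_dist\<close>, so that facts about balls follow by induction;
  \<open>graph_dist_le_iff\<close> identifies the two.\<close>

fun reach :: "'a sgraph \<Rightarrow> 'a \<Rightarrow> nat \<Rightarrow> 'a set" where
  "reach G v 0 = {v}"
| "reach G v (Suc r) = reach G v r \<union> {y. \<exists>x\<in>reach G v r. {x, y} \<in> edges G}"

lemma reach_mono: "r \<le> s \<Longrightarrow> reach G v r \<subseteq> reach G v s"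
  by (induction s) (auto simp: le_Suc_eq)

lemma root_in_reach: "v \<in> reach G v r"
  using reach_mono[of 0 r G v] by auto

lemma simple_graph_edgeD:
  assumes "simple_graph G" "{x, y} \<in> edges G"
  shows "x \<in> vertices G" "y \<in> vertices G" "x \<noteq> y"
  using assms unfolding simple_graph_def by (metis doubleton_eq_iff)+

lemma reach_subset_vertices:
  assumes "simple_graph G" "v \<in> vertices G"
  shows "reach G v r \<subseteq> vertices G"
  using assms by (induction r) (auto dest: simple_graph_edgeD)

text \<open>Edges need to be preserved only inside the ball of radius \<open>r\<close>, since
  everything nearer is reached through it. Hence this applies to maps between balls and, with the
  identity, to graphs that agree on a ball.\<close>

lemma reach_image_subset:
  assumes "\<And>a b. a \<in> reach G x r \<Longrightarrow> b \<in> reach G x r \<Longrightarrow> {a, b} \<in> edges G \<Longrightarrow> {f a, f b} \<in> edges G'"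
  shows "s \<le> r \<Longrightarrow> f ` reach G x s \<subseteq> reach G' (f x) s"
proof (induction s)
  case (Suc s)
  have "f y \<in> reach G' (f x) (Suc s)" if y: "y \<in> reach G x (Suc s)" for y
  proof (cases "y \<in> reach G x s")
    case True
    then show ?thesis using Suc by auto
  next
    case False
    then obtain z where z: "z \<in> reach G x s" "{z, y} \<in> edges G" using y by auto
    have "z \<in> reach G x r" "y \<in> reach G x r"
      using z(1) y Suc.prems reach_mono[of s r G x] reach_mono[of "Suc s" r G x] by auto
    then have "{f z, f y} \<in> edges G'" using assms z by blast
    then show ?thesis using z Suc by auto
  qed
  then show ?case by blast
qed auto

lemma reach_add: "x \<in> reach G v s \<Longrightarrow> reach G x r \<subseteq> reach G v (s + r)"
  by (induction r) auto

lemma finite_reach: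
  assumes "simple_graph G" "locally_finite G" "v \<in> vertices G"
  shows "finite (reach G v r)"
proof (induction r)
  case (Suc r)
  have "{y. \<exists>x\<in>reach G v r. {x, y} \<in> edges G} = (\<Union>x\<in>reach G v r. neighbours G x)"
    by (auto simp: neighbours_def)
  then show ?case
    using Suc assms reach_subset_vertices[OF assms(1,3), of r] by (auto simp: locally_finite_def)
qed simp

lemma walk_reach: "walk G xs \<Longrightarrow> last xs \<in> reach G (hd xs) (length xs - 1)"
proof (induction xs rule: rev_induct)
  case (snoc y xs)
  show ?case
  proof (cases "xs = []")
    case False
    then have "walk G xs" "{last xs, y} \<in> edges G"
      using snoc.prems by (auto simp: walk_def successively_append_iff)
    moreover obtain n where "length xs = Suc n" using False by (cases xs) auto
    ultimately show ?thesis using snoc.IH False by auto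
  qed simp
qed (simp add: walk_def)

lemma reach_walk:
  assumes "simple_graph G" "v \<in> vertices G"
  shows "u \<in> reach G v r \<Longrightarrow> \<exists>xs. walk G xs \<and> hd xs = v \<and> last xs = u \<and> length xs \<le> Suc r"
proof (induction r arbitrary: u)
  case 0
  then show ?case using assms by (intro exI[of _ "[v]"]) (auto simp: walk_def)
next
  case (Suc r)
  show ?case
  proof (cases "u \<in> reach G v r")
    case True
    then show ?thesis using Suc.IH le_Suc_eq by blast
  next
    case False
    then obtain x where x: "x \<in> reach G v r" "{x, u} \<in> edges G" using Suc.prems by auto
    then obtain xs where xs: "walk G xs" "hd xs = v" "last xs = x" "length xs \<le> Suc r"
      using Suc.IH by blast
    moreover have "walk G (xs @ [u])"
      using xs x simple_graph_edgeD[OF assms(1) x(2)] by (auto simp: walk_def successively_append_iff)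
    moreover have "xs \<noteq> []" using xs by (auto simp: walk_def)
    ultimately show ?thesis by (intro exI[of _ "xs @ [u]"]) auto
  qed
qed

lemma graph_connectedI:
  assumes "simple_graph G" "v \<in> vertices G" "\<And>u. u \<in> vertices G \<Longrightarrow> \<exists>r. u \<in> reach G v r"
  shows "graph_connected G"
proof -
  have "\<exists>xs. walk G xs \<and> hd xs = u \<and> last xs = w" if u: "u \<in> vertices G" and w: "w \<in> vertices G" for u w
  proof -
    obtain xs where xs: "walk G xs" "hd xs = v" "last xs = u"
      using assms(3)[OF u] reach_walk[OF assms(1,2)] by blast
    obtain ys where ys: "walk G ys" "hd ys = v" "last ys = w"
      using assms(3)[OF w] reach_walk[OF assms(1,2)] by blast
    from ys obtain zs where z: "ys = v # zs" by (cases ys) (auto simp: walk_def)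
    have "walk G (rev xs @ zs)" using xs ys z
      by (cases zs) (auto simp: walk_def successively_append_iff insert_commute last_rev)
    moreover have "hd (rev xs @ zs) = u" "last (rev xs @ zs) = w"
      using xs ys z by (auto simp: walk_def hd_rev last_rev)
    ultimately show ?thesis by blast
  qed
  then show ?thesis using assms(2) by (auto simp: graph_connected_def)
qed

lemma graph_dist_le_iff:
  assumes "is_graph G" "v \<in> vertices G" "u \<in> vertices G"
  shows "graph_dist G v u \<le> r \<longleftrightarrow> u \<in> reach G v r"
proof
  let ?P = "\<lambda>n. \<exists>xs. walk G xs \<and> hd xs = v \<and> last xs = u \<and> length xs = Suc n"
  have s: "simple_graph G" using assms by (simp add: is_graph_def)
  obtain xs where xs: "walk G xs" "hd xs = v" "last xs = u"
    using assms by (auto simp: is_graph_def graph_connected_def)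
  then have "length xs = Suc (length xs - 1)" by (cases xs) (auto simp: walk_def)
  then have "?P (length xs - 1)" using xs by blast
  then have "?P (graph_dist G v u)" unfolding graph_dist_def by (rule LeastI)
  then have "u \<in> reach G v (graph_dist G v u)" using walk_reach by fastforce
  then show "u \<in> reach G v r" if "graph_dist G v u \<le> r" using reach_mono[OF that, of G v] by blast
  show "graph_dist G v u \<le> r" if u: "u \<in> reach G v r"
  proof -
    obtain ys where ys: "walk G ys" "hd ys = v" "last ys = u" "length ys \<le> Suc r"
      using reach_walk[OF s assms(2) u] by blast
    then obtain n where n: "length ys = Suc n" by (cases ys) (auto simp: walk_def)
    then have "graph_dist G v u \<le> n" unfolding graph_dist_def using ys by (intro Least_le) blast
    then show ?thesis using n ys by simp
  qed
qed

lemma ex_reach: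
  assumes "is_graph G" "v \<in> vertices G" "u \<in> vertices G"
  shows "\<exists>r. u \<in> reach G v r"
  using graph_dist_le_iff[OF assms] by blast

lemma graph_ball_eq:
  assumes "is_graph G" "v \<in> vertices G"
  shows "graph_ball G v r = induced_on G (reach G v r)"
proof -
  have "{u \<in> vertices G. graph_dist G v u \<le> r} = reach G v r"
    using graph_dist_le_iff[OF assms] reach_subset_vertices[of G v r] assms
    by (auto simp: is_graph_def)
  then show ?thesis by (simp add: graph_ball_def)
qed

lemma vertices_graph_ball:
  "is_graph G \<Longrightarrow> v \<in> vertices G \<Longrightarrow> vertices (graph_ball G v r) = reach G v r"
  by (simp add: graph_ball_eq induced_on_def)

lemma edges_graph_ball:
  "is_graph G \<Longrightarrow> v \<in> vertices G \<Longrightarrow>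
    {a, b} \<in> edges (graph_ball G v r) \<longleftrightarrow> {a, b} \<in> edges G \<and> a \<in> reach G v r \<and> b \<in> reach G v r"
  by (simp add: graph_ball_eq induced_on_def)

lemma simple_graph_ball: "simple_graph G \<Longrightarrow> simple_graph (graph_ball G v r)"
  by (fastforce simp: simple_graph_def graph_ball_def induced_on_def)

lemma simple_graph_eqI:
  assumes "simple_graph G" "simple_graph G'" "vertices G = vertices G'"
    "\<And>a b. {a, b} \<in> edges G \<longleftrightarrow> {a, b} \<in> edges G'"
  shows "G = (G' :: 'a sgraph)"
proof -
  have "e \<in> edges G \<longleftrightarrow> e \<in> edges G'" for e
    using assms unfolding simple_graph_def by metis
  then show ?thesis using assms(3) by (intro sgraph.equality) auto
qed

text \<open>Although \<open>f\<close> is an isomorphism of the \<open>r\<close>-balls only, walks of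
  length at most \<open>r\<close> from the centre never leave these balls, so distances from the
  centre survive in both directions.\<close>

lemma graph_iso_ball_reach:
  assumes "is_graph G" "v \<in> vertices G" "is_graph G'" "v' \<in> vertices G'"
    and "graph_iso f (graph_ball G v r) (graph_ball G' v' r)" "f v = v'" "s \<le> r"
  shows "f ` reach G v s = reach G' v' s"
proof -
  \<comment> \<open>Stated for arbitrary graphs, since it is used for \<open>f\<close> and for its
    inverse.\<close>
  have *: "f ` reach G v s \<subseteq> reach G' v' s"
    if "is_graph G" "v \<in> vertices G" "is_graph G'" "v' \<in> vertices G'"
     "graph_iso f (graph_ball G v r) (graph_ball G' v' r)" "f v = v'"
    for f and G :: "'c sgraph" and G' :: "'d sgraph" and v v'
    using reach_image_subset[of G v r f G' s] that assms(7)
    by (auto simp: graph_iso_def edges_graph_ball vertices_graph_ball)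
  let ?g = "inv_into (reach G v r) f"
  have bij: "bij_betw f (reach G v r) (reach G' v' r)"
    using assms by (simp add: graph_iso_def vertices_graph_ball)
  have "?g v' = v" using bij assms(6) root_in_reach by (metis bij_betw_inv_into_left)
  moreover have "graph_iso ?g (graph_ball G' v' r) (graph_ball G v r)"
    using graph_iso_inv[OF assms(5)] assms by (simp add: vertices_graph_ball)
  ultimately have g: "?g ` reach G' v' s \<subseteq> reach G v s" using *[of G' v' G v ?g] assms by blast
  have "x \<in> f ` reach G v s" if "x \<in> reach G' v' s" for x
  proof -
    have "f (?g x) = x" using bij that reach_mono[OF assms(7), of G' v']
      by (metis bij_betw_inv_into_right subsetD)
    then show ?thesis using g that by (metis image_eqI image_subset_iff)
  qed
  then show ?thesis using *[of G v G' v' f] assms by blast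
qed

lemma graph_iso_ball_mono:
  assumes "is_graph G" "v \<in> vertices G" "is_graph G'" "v' \<in> vertices G'"
    and "graph_iso f (graph_ball G v r) (graph_ball G' v' r)" "f v = v'" "s \<le> r"
  shows "graph_iso f (graph_ball G v s) (graph_ball G' v' s)"
proof -
  note im = graph_iso_ball_reach[OF assms(1-6)]
  have bij: "bij_betw f (reach G v r) (reach G' v' r)"
    using assms by (simp add: graph_iso_def vertices_graph_ball)
  have sub: "reach G v s \<subseteq> reach G v r" "reach G' v' s \<subseteq> reach G' v' r"
    using assms(7) by (auto intro: reach_mono[THEN subsetD])
  then have "bij_betw f (reach G v s) (reach G' v' s)"
    using bij im[OF assms(7)] by (auto simp: bij_betw_def intro: inj_on_subset)
  moreover have "{a, b} \<in> edges G \<longleftrightarrow> {f a, f b} \<in> edges G'"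
    if "a \<in> reach G v s" "b \<in> reach G v s" for a b
  proof -
    have ab: "a \<in> reach G v r" "b \<in> reach G v r" using that sub by auto
    moreover have "f a \<in> reach G' v' r" "f b \<in> reach G' v' r" using ab bij bij_betw_apply by metis+
    ultimately show ?thesis using assms(1-5) by (auto simp: graph_iso_def edges_graph_ball vertices_graph_ball)
  qed
  moreover have "f a \<in> reach G' v' s" if "a \<in> reach G v s" for a using im[OF assms(7)] that by blast
  ultimately show ?thesis using assms(1-4)
    by (auto simp: graph_iso_def edges_graph_ball vertices_graph_ball)
qed

lemma rooted_isomorphic_ball:
  assumes "is_graph G" "v \<in> vertices G" "graph_iso g G G'" "is_graph G'"
  shows "rooted_isomorphic (graph_ball G v r) v (graph_ball G' (g v) r) (g v)"
proof -
  have bij: "bij_betw g (vertices G) (vertices G')" using assms by (simp add: graph_iso_def)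
  then have gv: "g v \<in> vertices G'" using assms bij_betw_apply by metis
  have sub_vertices: "reach G v r \<subseteq> vertices G" "reach G' (g v) r \<subseteq> vertices G'"
    using reach_subset_vertices[of G v r] reach_subset_vertices[of G' "g v" r] assms gv
    by (simp_all add: is_graph_def)
  have sub: "f ` reach H v r \<subseteq> reach H' (f v) r" if "is_graph H" "v \<in> vertices H" "graph_iso f H H'"
    for f and H :: "'c sgraph" and H' :: "'d sgraph" and v
  proof (rule reach_image_subset[OF _ order_refl])
    fix a b assume "{a, b} \<in> edges H"
    then show "{f a, f b} \<in> edges H'"
      using that simple_graph_edgeD[of H a b] by (auto simp: graph_iso_def is_graph_def)
  qed
  let ?g = "inv_into (vertices G) g"
  have inv: "?g (g v) = v" using bij assms by (metis bij_betw_inv_into_left)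
  have "?g ` reach G' (g v) r \<subseteq> reach G v r"
    using sub[OF assms(4) gv graph_iso_inv[OF assms(3)]] inv by simp
  then have "g ` ?g ` reach G' (g v) r \<subseteq> g ` reach G v r" by (rule image_mono)
  moreover have "g ` ?g ` reach G' (g v) r = reach G' (g v) r"
    using sub_vertices(2) bij by (simp add: bij_betw_def image_inv_into_cancel)
  ultimately have "reach G' (g v) r \<subseteq> g ` reach G v r" by simp
  then have im: "g ` reach G v r = reach G' (g v) r"
    using sub[OF assms(1-3)] by blast
  have "inj_on g (reach G v r)"
    using bij sub_vertices(1) unfolding bij_betw_def by (blast intro: inj_on_subset)
  then have "bij_betw g (reach G v r) (reach G' (g v) r)"
    using im unfolding bij_betw_def by blast
  moreover have "{a, b} \<in> edges G \<longleftrightarrow> {g a, g b} \<in> edges G'"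
    if "a \<in> reach G v r" "b \<in> reach G v r" for a b
    using assms(3) sub_vertices(1) that unfolding graph_iso_def by blast
  moreover have "g a \<in> reach G' (g v) r" if "a \<in> reach G v r" for a using im that by blast
  ultimately have "graph_iso g (graph_ball G v r) (graph_ball G' (g v) r)"
    unfolding graph_iso_def edges_graph_ball[OF assms(1,2)] edges_graph_ball[OF assms(4) gv]
      vertices_graph_ball[OF assms(1,2)] vertices_graph_ball[OF assms(4) gv] by blast
  then show ?thesis
    unfolding rooted_isomorphic_def vertices_graph_ball[OF assms(1,2)] vertices_graph_ball[OF assms(4) gv]
    using root_in_reach[of v G r] root_in_reach[of "g v" G' r] by blast
qed

text \<open>By the triangle inequality the ball about \<open>x\<close> stays inside the common
  \<open>R\<close>-ball about \<open>v\<close>. This carries balls about arbitrary vertices over to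
  a limit that is built from balls about a single root.\<close>

lemma graph_ball_cong:
  assumes "is_graph G" "v \<in> vertices G" "is_graph G'" "v \<in> vertices G'"
    and eq: "graph_ball G v R = graph_ball G' v R" and x: "x \<in> reach G v s" "s + r \<le> R"
  shows "graph_ball G x r = graph_ball G' x r" "reach G x r = reach G' x r"
proof -
  have R: "reach G v R = reach G' v R" using arg_cong[OF eq, of vertices] assms(1-4)
    by (simp add: vertices_graph_ball)
  have E: "{a, b} \<in> edges G \<longleftrightarrow> {a, b} \<in> edges G'" if "a \<in> reach G v R" "b \<in> reach G v R" for a b
    using edges_graph_ball[OF assms(1,2), of a b R] edges_graph_ball[OF assms(3,4), of a b R] eq that R
    by simp
  have sub: "reach H x r \<subseteq> reach H' x r" if "x \<in> reach H v s" "s + r \<le> R"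
    and "\<And>a b. a \<in> reach H v R \<Longrightarrow> b \<in> reach H v R \<Longrightarrow> {a, b} \<in> edges H \<Longrightarrow> {a, b} \<in> edges H'"
    for H H' :: "'a sgraph" and x s r
  proof -
    have "reach H x r \<subseteq> reach H v R"
      using reach_add[OF that(1), of r] reach_mono[OF that(2), of H v] by blast
    then show ?thesis using reach_image_subset[of H x r id H' r] that(3) by auto
  qed
  have same: "reach G x r = reach G' x r"
    if "x \<in> reach G v s" "x \<in> reach G' v s" "s + r \<le> R" for x s r
    using sub[of x G s r G'] sub[of x G' s r G] that E R by auto
  \<comment> \<open>The instance with centre \<open>v\<close> itself, which shows that
    \<open>x\<close> is within distance \<open>s\<close> of \<open>v\<close> in \<open>G'\<close> as
    well.\<close>
  have "x \<in> reach G' v s" using same[of v 0 s] x by simp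
  then show reach: "reach G x r = reach G' x r" using same x by blast
  have "reach G x r \<subseteq> reach G v R"
    using reach_add[OF x(1), of r] reach_mono[OF x(2), of G v] by blast
  then have e: "{a, b} \<in> edges G \<longleftrightarrow> {a, b} \<in> edges G'" if "a \<in> reach G x r" "b \<in> reach G x r" for a b
    using E that by blast
  have "x \<in> vertices G" "x \<in> vertices G'"
    using reach_subset_vertices assms(1-4) x(1) \<open>x \<in> reach G' v s\<close> by (metis is_graph_def subsetD)+
  then show "graph_ball G x r = graph_ball G' x r"
    using assms(1,3) reach e
    by (intro simple_graph_eqI simple_graph_ball)
       (auto simp: is_graph_def vertices_graph_ball edges_graph_ball)
qed

section \<open>Trees with levels and subdivisions of \<open>T\<^sub>\<infinity>\<close>\<close>

text \<open>The root is 0 and \<open>p m\<close> is the parent of \<open>Suc m\<close>. If parents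
  get smaller numbers than their children, maps on the tree can be built and studied by recursion on
  the number.\<close>

definition parent_tree :: "(nat \<Rightarrow> nat) \<Rightarrow> nat sgraph" where
  "parent_tree p = \<lparr>vertices = UNIV, edges = {{p m, Suc m} | m. True}\<rparr>"

text \<open>The \<open>min\<close> ensures termination for every \<open>p\<close>; it is redundant if \<open>p m \<le> m\<close>.\<close>

fun parent_rec :: "(nat \<Rightarrow> nat) \<Rightarrow> 'a \<Rightarrow> (nat \<Rightarrow> 'a \<Rightarrow> 'a) \<Rightarrow> nat \<Rightarrow> 'a" where
  "parent_rec p a g 0 = a"
| "parent_rec p a g (Suc m) = g m (parent_rec p a g (min m (p m)))"

context
  fixes p :: "nat \<Rightarrow> nat"
  assumes p: "p m \<le> m"
begin

lemma parent_tree_edge_iff: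
  "{x, y} \<in> edges (parent_tree p) \<longleftrightarrow> (\<exists>m. x = p m \<and> y = Suc m \<or> y = p m \<and> x = Suc m)"
  by (auto simp: parent_tree_def doubleton_eq_iff)

lemma parent_tree_smaller_unique:
  assumes "{z, x} \<in> edges (parent_tree p)" "x \<le> z" "{z, y} \<in> edges (parent_tree p)" "y \<le> z"
  shows "x = y"
proof -
  have "z = Suc (z - 1) \<and> w = p (z - 1)" if w: "{z, w} \<in> edges (parent_tree p)" "w \<le> z" for w
  proof -
    obtain m where m: "z = p m \<and> w = Suc m \<or> w = p m \<and> z = Suc m"
      using w(1) unfolding parent_tree_edge_iff by blast
    then show ?thesis using p[of m] w(2) by auto
  qed
  then show ?thesis using assms by metis
qed

lemma parent_tree_reach: "\<exists>r. n \<in> reach (parent_tree p) 0 r"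
proof (induction n rule: less_induct)
  case (less n)
  show ?case
  proof (cases n)
    case 0
    then show ?thesis by (intro exI[of _ 0]) simp
  next
    case (Suc m)
    then have "p m < n" using p[of m] by simp
    then obtain r where r: "p m \<in> reach (parent_tree p) 0 r" using less by blast
    have "{p m, n} \<in> edges (parent_tree p)" using Suc by (auto simp: parent_tree_def)
    then have "n \<in> reach (parent_tree p) 0 (Suc r)" using r by auto
    then show ?thesis by blast
  qed
qed

text \<open>The largest vertex of a cycle would have two different smaller neighbours, but only its
  parent is smaller.\<close>

lemma parent_tree_acyclic: "\<not> is_cycle (parent_tree p) xs"
proof
  assume "is_cycle (parent_tree p) xs"
  then have w: "walk (parent_tree p) xs" and d: "distinct xs" and len: "length xs \<ge> 3"
    and lh: "{last xs, hd xs} \<in> edges (parent_tree p)"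
    by (auto simp: is_cycle_def graph_path_def)
  have ne: "xs \<noteq> []" using len by auto
  have "Max (set xs) \<in> set xs" using ne by simp
  then obtain ys zs where xs: "xs = ys @ Max (set xs) # zs" by (meson split_list)
  define z where "z = Max (set xs)"
  \<comment> \<open>The rest of the cycle, read from the largest vertex \<open>z\<close> onwards;
    its two ends are the neighbours of \<open>z\<close> on the cycle.\<close>
  define vs where "vs = zs @ ys"
  have set: "set xs = insert z (set vs)" by (subst xs) (auto simp: vs_def z_def)
  have le: "y \<le> z" if "y \<in> set vs" for y unfolding z_def using that by (intro Max_ge) (auto simp: set)
  have "length xs = Suc (length vs)" by (subst xs) (simp add: vs_def)
  then have lv: "length vs \<ge> 2" using len by simp
  have dv: "distinct vs" using d by (subst (asm) xs) (auto simp: vs_def)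
  have s: "successively (\<lambda>u v. {u, v} \<in> edges (parent_tree p)) (ys @ z # zs)"
    using w xs by (simp add: walk_def z_def)
  have lh': "{last (ys @ z # zs), hd (ys @ z # zs)} \<in> edges (parent_tree p)"
    using lh xs by (simp add: z_def)
  have "{z, hd vs} \<in> edges (parent_tree p)"
  proof (cases "zs = []")
    case True
    then have "ys \<noteq> []" using lv by (auto simp: vs_def)
    then show ?thesis using lh' True by (simp add: vs_def)
  next
    case False
    then show ?thesis using s by (cases zs) (auto simp: vs_def successively_append_iff)
  qed
  moreover have "{z, last vs} \<in> edges (parent_tree p)"
  proof (cases "ys = []")
    case True
    then have "zs \<noteq> []" using lv by (auto simp: vs_def)
    then show ?thesis using lh' True by (simp add: vs_def insert_commute)
  next
    case False
    then show ?thesis using s by (simp add: vs_def successively_append_iff insert_commute)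
  qed
  moreover have "vs \<noteq> []" using lv by auto
  ultimately have "hd vs = last vs"
    using parent_tree_smaller_unique[of z "hd vs" "last vs"] le by simp
  moreover obtain b c cs where "vs = b # c # cs" using lv by (metis Suc_le_length_iff numeral_2_eq_2)
  moreover from this have "last vs \<in> set (c # cs)" using last_in_set[of "c # cs"] by simp
  ultimately show False using dv by auto
qed

lemma is_tree_parent_tree: "is_tree (parent_tree p)"
proof -
  have s: "simple_graph (parent_tree p)"
    unfolding simple_graph_def
  proof
    fix e assume "e \<in> edges (parent_tree p)"
    then obtain m where "e = {p m, Suc m}" by (auto simp: parent_tree_def)
    moreover have "p m \<noteq> Suc m" using p[of m] by simp
    ultimately show "\<exists>u\<in>vertices (parent_tree p). \<exists>v\<in>vertices (parent_tree p). u \<noteq> v \<and> e = {u, v}"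
      unfolding parent_tree_def by auto
  qed
  then have "graph_connected (parent_tree p)"
    by (rule graph_connectedI[of _ 0]) (simp_all add: parent_tree_reach, simp add: parent_tree_def)
  then show ?thesis using s parent_tree_acyclic by (auto simp: is_tree_def is_graph_def)
qed

lemma parent_rec_Suc: "parent_rec p a g (Suc m) = g m (parent_rec p a g (p m))"
  using p[of m] by (simp add: min_absorb2)

end

lemma is_T_infinity_parent_tree:
  assumes "\<And>m. p m \<le> m" "\<And>v. infinite {m. p m = v}"
  shows "is_T_infinity (parent_tree p)"
proof -
  have "infinite (neighbours (parent_tree p) v)" for v
  proof -
    have "Suc ` {m. p m = v} \<subseteq> neighbours (parent_tree p) v"
      by (auto simp: neighbours_def parent_tree_def)
    moreover have "infinite (Suc ` {m. p m = v})" using assms(2) by (simp add: finite_image_iff)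
    ultimately show ?thesis by (rule infinite_super)
  qed
  then show ?thesis using is_tree_parent_tree[of p] assms(1) by (auto simp: is_T_infinity_def)
qed

lemma set_subset_inner_vertices:
  assumes "xs \<noteq> []"
  shows "set xs \<subseteq> {hd xs, last xs} \<union> inner_vertices xs"
proof (cases "tl xs = []")
  case True
  then show ?thesis using assms by (cases xs) auto
next
  case False
  have "xs = hd xs # tl xs" using assms by simp
  also have "tl xs = butlast (tl xs) @ [last xs]"
    using False assms by (metis append_butlast_last_id last_tl)
  finally have "set xs = set (hd xs # butlast (tl xs) @ [last xs])" by simp
  then show ?thesis by (auto simp: inner_vertices_def)
qed

lemma inner_vertices_rev: "inner_vertices (rev xs) = inner_vertices xs"
proof -
  have "butlast (tl (rev xs)) = rev (tl (butlast xs))"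
    by (metis butlast_rev butlast_tl rev_swap)
  then show ?thesis by (simp add: inner_vertices_def butlast_tl)
qed

lemma path_edges_rev: "path_edges (rev xs) = path_edges xs"
proof -
  have "path_edges (rev xs) \<subseteq> path_edges xs" for xs :: "'a list"
  proof
    fix e assume "e \<in> path_edges (rev xs)"
    then obtain i where i: "Suc i < length xs" "e = {rev xs ! i, rev xs ! Suc i}"
      by (auto simp: path_edges_def)
    define j where "j = length xs - Suc (Suc i)"
    have "Suc j < length xs" "rev xs ! i = xs ! Suc j" "rev xs ! Suc i = xs ! j"
      using i(1) by (auto simp: j_def rev_nth Suc_diff_Suc)
    then show "e \<in> path_edges xs" using i(2) by (auto simp: path_edges_def insert_commute)
  qed
  from this[of xs] this[of "rev xs"] show ?thesis by auto
qed

text \<open>Abstracts the tree of balls: \<open>ht\<close> is the radius and \<open>anc t s\<close>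
  the concentric ball of radius \<open>s\<close>. Having the ancestors at all levels as a function
  makes the order and the paths of the tree computable without walks.\<close>

locale level_tree =
  fixes N :: "'a set" and ht :: "'a \<Rightarrow> nat" and anc :: "'a \<Rightarrow> nat \<Rightarrow> 'a"
  assumes anc_in: "t \<in> N \<Longrightarrow> s \<le> ht t \<Longrightarrow> anc t s \<in> N"
    and ht_anc: "t \<in> N \<Longrightarrow> s \<le> ht t \<Longrightarrow> ht (anc t s) = s"
    and anc_self: "t \<in> N \<Longrightarrow> anc t (ht t) = t"
    and anc_anc: "t \<in> N \<Longrightarrow> s \<le> s' \<Longrightarrow> s' \<le> ht t \<Longrightarrow> anc (anc t s') s = anc t s"
begin

definition tree :: "'a sgraph" where
  "tree = \<lparr>vertices = N, edges = {{anc t (ht t - 1), t} | t. t \<in> N \<and> ht t \<ge> 1}\<rparr>"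

definition children :: "'a \<Rightarrow> 'a set" where
  "children u = {c \<in> N. ht c = Suc (ht u) \<and> anc c (ht u) = u}"

definition leq :: "'a \<Rightarrow> 'a \<Rightarrow> bool" where
  "leq u t \<longleftrightarrow> u \<in> N \<and> t \<in> N \<and> ht u \<le> ht t \<and> anc t (ht u) = u"

definition branching :: "'a set \<Rightarrow> bool" where
  "branching U \<longleftrightarrow> U \<noteq> {} \<and> U \<subseteq> N \<and> (\<forall>u\<in>U. infinite {c \<in> children u. \<exists>w\<in>U. leq c w})"

lemma leq_refl: "u \<in> N \<Longrightarrow> leq u u"
  by (simp add: leq_def anc_self)

lemma leq_trans: "leq u v \<Longrightarrow> leq v w \<Longrightarrow> leq u w"
  unfolding leq_def using anc_anc[of w "ht u" "ht v"] by auto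

lemma leq_linear: "leq u t \<Longrightarrow> leq v t \<Longrightarrow> ht u \<le> ht v \<Longrightarrow> leq u v"
  unfolding leq_def using anc_anc[of t "ht u" "ht v"] by auto

lemma leq_unique: "leq u t \<Longrightarrow> leq v t \<Longrightarrow> ht u = ht v \<Longrightarrow> u = v"
  by (auto simp: leq_def)

lemma leq_anc: "t \<in> N \<Longrightarrow> s \<le> ht t \<Longrightarrow> leq (anc t s) t"
  by (simp add: leq_def anc_in ht_anc)

lemma children_leq: "c \<in> children u \<Longrightarrow> leq u c"
  unfolding leq_def children_def using anc_in[of c "ht u"] by auto

lemma ht_children: "c \<in> children u \<Longrightarrow> ht c = Suc (ht u)"
  by (simp add: children_def)

lemma anc_Suc_children:
  assumes "t \<in> N" "Suc i \<le> ht t"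
  shows "anc t (Suc i) \<in> children (anc t i)"
  using assms by (simp add: children_def anc_in ht_anc anc_anc)

lemma tree_edge_iff: "{a, b} \<in> edges tree \<longleftrightarrow> b \<in> children a \<or> a \<in> children b"
proof -
  have "{a, b} \<in> edges tree \<longleftrightarrow> (\<exists>t\<in>N. ht t \<ge> 1 \<and>
      (a = anc t (ht t - 1) \<and> b = t \<or> b = anc t (ht t - 1) \<and> a = t))"
    by (auto simp: tree_def doubleton_eq_iff)
  moreover have "ht t \<ge> 1 \<and> u = anc t (ht t - 1) \<longleftrightarrow> t \<in> children u" if "t \<in> N" for t u
    using that ht_anc[OF that, of "ht t - 1"] by (auto simp: children_def)
  moreover have "c \<in> N" if "c \<in> children u" for c u using that by (simp add: children_def)
  ultimately show ?thesis by blast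
qed

text \<open>A path that starts away from the root can never turn back: a vertex has only one parent,
  and the path has just come from it. So all later vertices are descendants of the second
  one.\<close>

lemma ascending_path:
  assumes "successively (\<lambda>u v. {u, v} \<in> edges tree) xs" "distinct xs"
    and "xs ! 1 \<in> children (xs ! 0)" "Suc 0 < length xs"
  shows "Suc i < length xs \<Longrightarrow> xs ! Suc i \<in> children (xs ! i) \<and> leq (xs ! 1) (xs ! Suc i)"
proof (induction i)
  case 0
  then show ?case using assms(3) leq_refl by (auto simp: children_def)
next
  case (Suc i)
  have "{xs ! Suc i, xs ! Suc (Suc i)} \<in> edges tree"
    using assms(1) Suc.prems by (simp add: successively_conv_nth)
  moreover have "xs ! Suc i \<notin> children (xs ! Suc (Suc i))"
  proof
    assume c: "xs ! Suc i \<in> children (xs ! Suc (Suc i))"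
    have "xs ! Suc i \<in> children (xs ! i)" using Suc by simp
    then have "xs ! i = xs ! Suc (Suc i)" using c by (auto simp: children_def)
    then show False using assms(2) Suc.prems by (simp add: nth_eq_iff_index_eq)
  qed
  ultimately have "xs ! Suc (Suc i) \<in> children (xs ! Suc i)" unfolding tree_edge_iff by blast
  then show ?case using Suc children_leq leq_trans by (meson Suc_lessD)
qed

text \<open>The branch vertices form the branching set. The paths leaving a branch vertex have
  different second vertices, at most one of which is its parent; through every other one the path
  ascends to a further branch vertex.\<close>

lemma subdivision_imp_branching:
  assumes T: "is_T_infinity T" and sub: "contains_subdivision tree T"
  obtains U where "branching U"
proof -
  obtain S \<phi> P where S: "is_subgraph S tree" and inj: "inj_on \<phi> (vertices T)"
    and P': "\<forall>x y. {x, y} \<in> edges T \<longrightarrow> graph_path S (P x y) \<and> hd (P x y) = \<phi> x \<and>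
        last (P x y) = \<phi> y \<and> P y x = rev (P x y) \<and> inner_vertices (P x y) \<inter> \<phi> ` vertices T = {}"
    and disj': "\<forall>x y x' y'. {x, y} \<in> edges T \<and> {x', y'} \<in> edges T \<and> {x, y} \<noteq> {x', y'} \<longrightarrow>
        inner_vertices (P x y) \<inter> inner_vertices (P x' y') = {}"
    and VS': "vertices S = \<phi> ` vertices T \<union> \<Union>{inner_vertices (P x y) | x y. {x, y} \<in> edges T}"
    using sub unfolding contains_subdivision_def is_subdivision_def by (elim exE conjE) (rule that)
  have P: "graph_path S (P x y)" "hd (P x y) = \<phi> x" "last (P x y) = \<phi> y"
      "inner_vertices (P x y) \<inter> \<phi> ` vertices T = {}" if "{x, y} \<in> edges T" for x y
    using P' that by auto
  have disj: "inner_vertices (P x y) \<inter> inner_vertices (P x' y') = {}"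
    if "{x, y} \<in> edges T" "{x', y'} \<in> edges T" "{x, y} \<noteq> {x', y'}" for x y x' y'
    using disj' that by blast
  have VS: "\<phi> ` vertices T \<subseteq> vertices S" unfolding VS' by (rule Un_upper1)
  have sT: "simple_graph T" and ne: "vertices T \<noteq> {}"
    using T by (auto simp: is_T_infinity_def is_tree_def is_graph_def graph_connected_def)
  let ?U = "\<phi> ` vertices T"
  have "infinite {c \<in> children (\<phi> x). \<exists>w\<in>?U. leq c w}" if x: "x \<in> vertices T" for x
  proof -
    let ?f = "\<lambda>y. P x y ! 1"
    have path: "\<exists>b zs. P x y = \<phi> x # b # zs \<and> (zs = [] \<and> b = \<phi> y \<or> b \<in> inner_vertices (P x y))"
      if y: "{x, y} \<in> edges T" for y
    proof -
      have "\<phi> x \<noteq> \<phi> y" using simple_graph_edgeD[OF sT y] inj by (auto dest: inj_onD)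
      moreover have "P x y \<noteq> []" using P[OF y] by (auto simp: graph_path_def walk_def)
      ultimately obtain b zs where b: "P x y = \<phi> x # b # zs"
        using P[OF y] by (metis last_ConsL list.exhaust_sel)
      then show ?thesis using P[OF y] by (cases zs) (auto simp: inner_vertices_def)
    qed
    \<comment> \<open>A common second vertex of two paths cannot be an inner vertex of either, by
      the disjointness conditions, so it would be the end of both.\<close>
    have "inj_on ?f (neighbours T x)"
    proof (rule inj_onI, rule ccontr)
      fix y y' assume y: "y \<in> neighbours T x" "y' \<in> neighbours T x" "?f y = ?f y'" "y \<noteq> y'"
      have e: "{x, y} \<in> edges T" "{x, y'} \<in> edges T" using y by (auto simp: neighbours_def)
      have ne: "{x, y} \<noteq> {x, y'}" using y(4) by (auto simp: doubleton_eq_iff)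
      have yV: "y \<in> vertices T" "y' \<in> vertices T" using e simple_graph_edgeD[OF sT] by blast+
      have "?f y = \<phi> y \<or> ?f y \<in> inner_vertices (P x y)" "?f y' = \<phi> y' \<or> ?f y' \<in> inner_vertices (P x y')"
        using path[OF e(1)] path[OF e(2)] by auto
      then have "\<phi> y = \<phi> y'" using y(3) yV disj[OF e ne] P[OF e(1)] P[OF e(2)] by auto
      then show False using inj yV y(4) by (auto dest: inj_onD)
    qed
    moreover have "infinite (neighbours T x)" using T x by (simp add: is_T_infinity_def)
    ultimately have "infinite (?f ` neighbours T x)" by (simp add: finite_image_iff)
    \<comment> \<open>The inserted element is the parent, the only second vertex that does not lead
      upwards.\<close>
    moreover have "?f ` neighbours T x \<subseteq>
      insert (anc (\<phi> x) (ht (\<phi> x) - 1)) {c \<in> children (\<phi> x). \<exists>w\<in>?U. leq c w}"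
    proof
      fix c assume "c \<in> ?f ` neighbours T x"
      then obtain y where y: "{x, y} \<in> edges T" "c = P x y ! 1" by (auto simp: neighbours_def)
      obtain zs where zs: "P x y = \<phi> x # c # zs" using path[OF y(1)] y(2) by auto
      have "successively (\<lambda>u v. {u, v} \<in> edges S) (P x y)" and d: "distinct (P x y)"
        using P[OF y(1)] by (auto simp: graph_path_def walk_def)
      then have s: "successively (\<lambda>u v. {u, v} \<in> edges tree) (P x y)"
        using S by (auto simp: is_subgraph_def elim!: successively_mono)
      then have "{\<phi> x, c} \<in> edges tree" using zs by simp
      then consider "c \<in> children (\<phi> x)" | "\<phi> x \<in> children c" unfolding tree_edge_iff by blast
      then show "c \<in> insert (anc (\<phi> x) (ht (\<phi> x) - 1)) {c \<in> children (\<phi> x). \<exists>w\<in>?U. leq c w}"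
      proof cases
        case 1
        have "leq (P x y ! 1) (P x y ! Suc (length zs))"
          using ascending_path[OF s d, of "length zs"] 1 zs by simp
        moreover have "P x y ! Suc (length zs) = last (P x y)" using zs by (simp add: last_conv_nth)
        ultimately have "leq c (\<phi> y)" using P[OF y(1)] y(2) by simp
        moreover have "y \<in> vertices T" using simple_graph_edgeD[OF sT y(1)] by blast
        ultimately show ?thesis using 1 by blast
      next
        case 2
        then show ?thesis by (auto simp: children_def)
      qed
    qed
    ultimately show ?thesis using finite_subset by blast
  qed
  moreover have "?U \<subseteq> N" using VS S by (auto simp: is_subgraph_def tree_def)
  ultimately have "branching ?U" using ne by (auto simp: branching_def)
  then show ?thesis using that by blast
qed


lemma branching_imp_subdivision:
  assumes "branching U"
  shows "\<exists>T :: nat sgraph. is_T_infinity T \<and> contains_subdivision tree T"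
proof -
  have UN: "U \<subseteq> N" using assms by (simp add: branching_def)
  define ext where "ext u = {c \<in> children u. \<exists>w\<in>U. leq c w}" for u
  have "\<exists>f :: nat \<Rightarrow> 'a. inj f \<and> range f \<subseteq> ext u" if "u \<in> U" for u
    using assms that unfolding branching_def ext_def by (intro infinite_countable_subset) blast
  then obtain ch :: "'a \<Rightarrow> nat \<Rightarrow> 'a" where inj_ch: "\<And>u. u \<in> U \<Longrightarrow> inj (ch u)"
    and ch: "\<And>u k. u \<in> U \<Longrightarrow> ch u k \<in> ext u" by (metis rangeI subsetD)
  have "\<exists>w\<in>U. leq c w" if "c \<in> ext u" for c u using that by (simp add: ext_def)
  then obtain top where top: "\<And>c u. c \<in> ext u \<Longrightarrow> top c \<in> U \<and> leq c (top c)" by metis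
  obtain a where a: "a \<in> U" using assms by (auto simp: branching_def)
  \<comment> \<open>Via the pairing bijection, the vertex \<open>Suc m\<close> is the child with
    index \<open>k m\<close> of the vertex \<open>p m\<close>; thus each vertex is a parent
    infinitely often.\<close>
  define p k where "p m = fst (prod_decode m)" and "k m = snd (prod_decode m)" for m
  have p: "p m \<le> m" for m
    by (metis p_def fst_conv le_prod_encode_1 prod.collapse prod_decode_inverse)
  have pk: "m = m'" if "p m = p m'" "k m = k m'" for m m'
    using that by (metis p_def k_def prod_eq_iff prod_decode_eq)
  have "p (prod_encode (v, i)) = v" for v i by (simp add: p_def)
  moreover have "infinite (range (\<lambda>i. prod_encode (v, i)))" for v
    by (intro range_inj_infinite) (auto intro!: injI)
  ultimately have "infinite {m. p m = v}" for v
    by (metis (mono_tags, lifting) finite_subset image_subset_iff mem_Collect_eq)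
  then have T: "is_T_infinity (parent_tree p)" using p by (intro is_T_infinity_parent_tree)
  define \<phi> where "\<phi> = parent_rec p a (\<lambda>m u. top (ch u (k m)))"
  define c where "c m = ch (\<phi> (p m)) (k m)" for m
  have \<phi>_Suc: "\<phi> (Suc m) = top (c m)" for m
    by (simp only: \<phi>_def c_def parent_rec_Suc[OF p])
  have \<phi>_U: "\<phi> m \<in> U" for m
  proof (induction m rule: less_induct)
    case (less m)
    show ?case
    proof (cases m)
      case 0
      then show ?thesis using a by (simp add: \<phi>_def)
    next
      case (Suc i)
      then have "\<phi> (p i) \<in> U" using less p[of i] by simp
      then show ?thesis using top[OF ch] unfolding Suc \<phi>_Suc c_def by blast
    qed
  qed
  have \<phi>_N: "\<phi> m \<in> N" for m using \<phi>_U UN by blast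
  have c_ext: "c m \<in> ext (\<phi> (p m))" for m using ch[OF \<phi>_U] by (simp add: c_def)
  then have c: "c m \<in> children (\<phi> (p m))" for m by (simp add: ext_def)
  have c_top: "leq (c m) (\<phi> (Suc m))" for m using top[OF c_ext] \<phi>_Suc by simp
  have pc: "leq (\<phi> (p m)) (c m)" for m by (rule children_leq[OF c])
  have p_top: "leq (\<phi> (p m)) (\<phi> (Suc m))" for m using leq_trans[OF pc c_top] .
  have ht_c: "ht (c m) = Suc (ht (\<phi> (p m)))" for m by (rule ht_children[OF c])
  have ht_less: "ht (\<phi> (p m)) < ht (\<phi> (Suc m))" for m
    using c_top[of m] ht_c[of m] by (simp add: leq_def)
  have ht_0: "ht (\<phi> 0) \<le> ht (\<phi> m)" for m
  proof (induction m rule: less_induct)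
    case (less m)
    show ?case
    proof (cases m)
      case (Suc i)
      have "ht (\<phi> 0) \<le> ht (\<phi> (p i))" using less p[of i] Suc by simp
      then show ?thesis using ht_less[of i] Suc by simp
    qed simp
  qed
  \<comment> \<open>\<open>seg (Suc m)\<close> is the path to \<open>\<phi> (Suc m)\<close> from \<open>\<phi> (p m)\<close>, excluding \<open>\<phi> (p m)\<close>.\<close>
  define seg where "seg n = (case n of 0 \<Rightarrow> {\<phi> 0} | Suc m \<Rightarrow> {t. leq (c m) t \<and> leq t (\<phi> (Suc m))})" for n
  have \<phi>_seg: "\<phi> n \<in> seg n" for n
    using c_top leq_refl[OF \<phi>_N] by (cases n) (simp_all add: seg_def)
  have seg_Suc: "leq (c m) t" "leq t (\<phi> (Suc m))" "leq (\<phi> (p m)) t" "ht (\<phi> (p m)) < ht t"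
    if "t \<in> seg (Suc m)" for t m
  proof -
    show ct: "leq (c m) t" and "leq t (\<phi> (Suc m))" using that by (simp_all add: seg_def)
    show "leq (\<phi> (p m)) t" by (rule leq_trans[OF pc ct])
    show "ht (\<phi> (p m)) < ht t" using ct ht_c[of m] by (simp add: leq_def)
  qed
  have seg_0: "n = 0" if "\<phi> 0 \<in> seg n" for n
    using seg_Suc(4)[of "\<phi> 0" "n - 1"] ht_0[of "p (n - 1)"] that by (cases n) auto
  \<comment> \<open>A common point \<open>t\<close> of two segments has both lower ends
    \<open>\<phi> (p m)\<close> and \<open>\<phi> (p m')\<close> as ancestors, so these are
    comparable. If one is strictly higher, it lies on the other segment, which by induction is the
    segment ending in it, and then \<open>t\<close> cannot be above it. If they coincide, so do the
    parents by induction, then the children \<open>c m\<close> and \<open>c m'\<close> at the same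
    height below \<open>t\<close>, and finally the indices.\<close>
  have disjoint: "y = y'" if "t \<in> seg y" "t \<in> seg y'" for t y y'
    using that
  proof (induction "y + y'" arbitrary: t y y' rule: less_induct)
    case less
    show ?case
    proof (cases "y = 0 \<or> y' = 0")
      case True
      then show ?thesis using less.prems seg_0 by (auto simp: seg_def)
    next
      case False
      then obtain m m' where m: "y = Suc m" "y' = Suc m'" by (meson not0_implies_Suc)
      note t = seg_Suc[OF less.prems(1)[unfolded m]] and t' = seg_Suc[OF less.prems(2)[unfolded m]]
      have *: False if IH: "\<And>t. t \<in> seg (Suc i) \<Longrightarrow> t \<in> seg (p j) \<Longrightarrow> Suc i = p j"
        and i: "t \<in> seg (Suc i)" and j: "t \<in> seg (Suc j)" and lt: "ht (\<phi> (p i)) < ht (\<phi> (p j))" for i j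
      proof -
        have "leq (c i) (\<phi> (p j))"
          using leq_linear[OF seg_Suc(1)[OF i] seg_Suc(3)[OF j]] lt ht_c[of i] by simp
        moreover have "leq (\<phi> (p j)) (\<phi> (Suc i))" by (rule leq_trans[OF seg_Suc(3)[OF j] seg_Suc(2)[OF i]])
        ultimately have "\<phi> (p j) \<in> seg (Suc i)" by (simp add: seg_def)
        then have "Suc i = p j" using IH \<phi>_seg by blast
        then have "ht t \<le> ht (\<phi> (p j))" using seg_Suc(2)[OF i] by (simp add: leq_def)
        then show False using seg_Suc(4)[OF j] by simp
      qed
      have "\<not> ht (\<phi> (p m)) < ht (\<phi> (p m'))"
        using *[of m m'] less.hyps[of "Suc m" "p m'"] less.prems m p[of m'] by auto
      moreover have "\<not> ht (\<phi> (p m')) < ht (\<phi> (p m))"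
        using *[of m' m] less.hyps[of "Suc m'" "p m"] less.prems m p[of m] by auto
      ultimately have ht_eq: "ht (\<phi> (p m)) = ht (\<phi> (p m'))" by simp
      then have "\<phi> (p m) = \<phi> (p m')" using leq_unique[OF t(3) t'(3)] by blast
      then have pp: "p m = p m'"
        using less.hyps[of "p m" "p m'" "\<phi> (p m)"] \<phi>_seg[of "p m"] \<phi>_seg[of "p m'"] m p[of m] p[of m'] by simp
      have "c m = c m'" using leq_unique[OF t(1) t'(1)] ht_eq ht_c by simp
      then have "k m = k m'" using inj_ch[OF \<phi>_U] pp by (auto simp: c_def dest: injD)
      then show ?thesis using pp pk m by simp
    qed
  qed
  have inj_\<phi>: "inj \<phi>" using disjoint \<phi>_seg by (metis injI)
  \<comment> \<open>The path that replaces the edge from \<open>p m\<close> to \<open>Suc m\<close>;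
    unlike \<open>seg\<close> it includes the lower end.\<close>
  define Q where "Q m = map (anc (\<phi> (Suc m))) [ht (\<phi> (p m))..<Suc (ht (\<phi> (Suc m)))]" for m
  have Q_ne: "Q m \<noteq> []" for m using ht_less[of m] by (simp add: Q_def)
  have hd_Q: "hd (Q m) = \<phi> (p m)" for m
    using ht_less[of m] p_top[of m] by (simp add: Q_def hd_map leq_def del: upt_Suc)
  have last_Q: "last (Q m) = \<phi> (Suc m)" for m
    using ht_less[of m] by (simp add: Q_def last_map anc_self[OF \<phi>_N])
  have "inj_on (anc (\<phi> (Suc m))) {ht (\<phi> (p m))..ht (\<phi> (Suc m))}" for m
    by (rule inj_on_inverseI[of _ ht]) (simp add: ht_anc[OF \<phi>_N])
  then have distinct_Q: "distinct (Q m)" for m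
    unfolding Q_def distinct_map set_upt by (simp only: atLeastLessThanSuc_atLeastAtMost distinct_upt simp_thms)
  have inner_Q: "inner_vertices (Q m) = anc (\<phi> (Suc m)) ` {ht (\<phi> (p m))<..<ht (\<phi> (Suc m))}" for m
  proof -
    have "[ht (\<phi> (p m))..<Suc (ht (\<phi> (Suc m)))] =
        ht (\<phi> (p m)) # [Suc (ht (\<phi> (p m)))..<ht (\<phi> (Suc m))] @ [ht (\<phi> (Suc m))]"
      using ht_less[of m] by (simp add: upt_rec[of "ht (\<phi> (p m))" "ht (\<phi> (Suc m))"])
    then show ?thesis by (simp add: inner_vertices_def Q_def atLeastSucLessThan_greaterThanLessThan del: upt_Suc)
  qed
  have inner_seg: "inner_vertices (Q m) \<subseteq> seg (Suc m)" for m
  proof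
    fix t assume "t \<in> inner_vertices (Q m)"
    then obtain s where s: "t = anc (\<phi> (Suc m)) s" "ht (\<phi> (p m)) < s" "s < ht (\<phi> (Suc m))"
      unfolding inner_Q by auto
    have t: "leq t (\<phi> (Suc m))" "ht t = s" using s leq_anc[OF \<phi>_N] ht_anc[OF \<phi>_N] by simp_all
    then show "t \<in> seg (Suc m)"
      using leq_linear[OF c_top t(1)] s ht_c[of m] by (simp add: seg_def)
  qed
  have inner_\<phi>: "inner_vertices (Q m) \<inter> range \<phi> = {}" for m
  proof -
    have False if n: "\<phi> n \<in> inner_vertices (Q m)" for n
    proof -
      have "n = Suc m" using disjoint[OF \<phi>_seg] inner_seg n by blast
      then obtain s where "\<phi> n = anc (\<phi> n) s" "s < ht (\<phi> n)" using n unfolding inner_Q by auto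
      then show False using ht_anc[OF \<phi>_N, of s n] by simp
    qed
    then show ?thesis by blast
  qed
  have inner_disj: "inner_vertices (Q m) \<inter> inner_vertices (Q m') = {}" if "m \<noteq> m'" for m m'
    using disjoint inner_seg that by (metis disjoint_iff nat.inject subsetD)
  \<comment> \<open>The parent has the smaller number, so \<open>x < y\<close> says that the edge is
    traversed upwards; \<open>Q\<close> is indexed by the predecessor of the upper end.\<close>
  define P where "P x y = (if x < y then Q (y - 1) else rev (Q (x - 1)))" for x y :: nat
  let ?T = "parent_tree p"
  have edge_cases: "\<exists>m. {x, y} = {p m, Suc m} \<and>
      (x = p m \<and> y = Suc m \<and> P x y = Q m \<and> P y x = rev (Q m) \<or>
       y = p m \<and> x = Suc m \<and> P x y = rev (Q m) \<and> P y x = Q m)" if e: "{x, y} \<in> edges ?T" for x y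
  proof -
    obtain m where m: "x = p m \<and> y = Suc m \<or> y = p m \<and> x = Suc m"
      using e unfolding parent_tree_edge_iff[OF p] by blast
    have "p m < Suc m" using p[of m] by simp
    then show ?thesis using m by (intro exI[of _ m]) (auto simp: P_def)
  qed
  \<comment> \<open>The definition of a subdivision lists every edge in both orientations; for
    quantities invariant under reversal, the upward paths suffice.\<close>
  have range_P: "{f (P x y) | x y. {x, y} \<in> edges ?T} = range (\<lambda>m. f (Q m))"
    if "\<And>xs. f (rev xs) = f xs" for f :: "'a list \<Rightarrow> 'b"
  proof (intro subset_antisym subsetI)
    fix X assume "X \<in> {f (P x y) | x y. {x, y} \<in> edges ?T}"
    then obtain x y where "X = f (P x y)" "{x, y} \<in> edges ?T" by blast
    then show "X \<in> range (\<lambda>m. f (Q m))" using edge_cases[of x y] that by auto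
  next
    fix X assume "X \<in> range (\<lambda>m. f (Q m))"
    then obtain m where "X = f (Q m)" by blast
    moreover have "{p m, Suc m} \<in> edges ?T" "P (p m) (Suc m) = Q m"
      using p[of m] by (auto simp: P_def parent_tree_def)
    ultimately show "X \<in> {f (P x y) | x y. {x, y} \<in> edges ?T}" by force
  qed
  define S where "S = \<lparr>vertices = range \<phi> \<union> \<Union>{inner_vertices (P x y) | x y. {x, y} \<in> edges ?T},
    edges = \<Union>{path_edges (P x y) | x y. {x, y} \<in> edges ?T}\<rparr>"
  have VS: "vertices S = range \<phi> \<union> (\<Union>m. inner_vertices (Q m))"
    by (simp add: S_def range_P[of inner_vertices, OF inner_vertices_rev])
  have ES: "edges S = (\<Union>m. path_edges (Q m))"
    by (simp add: S_def range_P[of path_edges, OF path_edges_rev])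
  have Q_VS: "set (Q m) \<subseteq> vertices S" for m
    using set_subset_inner_vertices[OF Q_ne, of m] unfolding VS hd_Q last_Q by blast
  have Q_edgeE: "\<exists>i. ht (\<phi> (p m)) \<le> i \<and> i < ht (\<phi> (Suc m)) \<and> e = {anc (\<phi> (Suc m)) i, anc (\<phi> (Suc m)) (Suc i)}"
    if e: "e \<in> path_edges (Q m)" for e m
  proof -
    obtain j where j: "Suc j < length (Q m)" "e = {Q m ! j, Q m ! Suc j}"
      using e unfolding path_edges_def by blast
    define i where "i = ht (\<phi> (p m)) + j"
    have "i < ht (\<phi> (Suc m))" using j(1) by (simp add: Q_def i_def del: upt_Suc)
    moreover have "Q m ! j = anc (\<phi> (Suc m)) i" "Q m ! Suc j = anc (\<phi> (Suc m)) (Suc i)"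
      using j(1) by (simp_all add: Q_def i_def del: upt_Suc)
    ultimately show ?thesis using j(2) by (intro exI[of _ i]) (simp add: i_def)
  qed
  have "is_subgraph S tree"
    unfolding is_subgraph_def
  proof (intro conjI)
    show "vertices S \<subseteq> vertices tree"
      using \<phi>_N anc_in[OF \<phi>_N] by (force simp: VS inner_Q tree_def)
    show "edges S \<subseteq> edges tree"
    proof
      fix e assume "e \<in> edges S"
      then obtain m i where "i < ht (\<phi> (Suc m))" "e = {anc (\<phi> (Suc m)) i, anc (\<phi> (Suc m)) (Suc i)}"
        unfolding ES using Q_edgeE by blast
      then show "e \<in> edges tree" using anc_Suc_children[OF \<phi>_N] tree_edge_iff by simp
    qed
    show "simple_graph S"
      unfolding simple_graph_def
    proof
      fix e assume "e \<in> edges S"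
      then obtain m i where i: "Suc i < length (Q m)" "e = {Q m ! i, Q m ! Suc i}"
        unfolding ES path_edges_def by blast
      then have "Q m ! i \<noteq> Q m ! Suc i" using distinct_Q[of m] by (simp add: nth_eq_iff_index_eq)
      moreover have "Q m ! i \<in> vertices S" "Q m ! Suc i \<in> vertices S"
        using Q_VS[of m] i(1) by (auto intro: subsetD[OF _ nth_mem])
      ultimately show "\<exists>u\<in>vertices S. \<exists>v\<in>vertices S. u \<noteq> v \<and> e = {u, v}" using i(2) by blast
    qed
  qed
  moreover have "is_subdivision S ?T"
    unfolding is_subdivision_def
  proof (intro exI[of _ \<phi>] exI[of _ P] conjI allI impI)
    have Q_path: "graph_path S (Q m)" for m
      using Q_VS[of m] Q_ne distinct_Q
      by (auto simp: graph_path_def walk_def successively_conv_nth ES path_edges_def)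
    then have Q_path': "graph_path S (rev (Q m))" for m
      by (simp add: graph_path_def walk_def insert_commute)
    have VT: "vertices ?T = UNIV" by (simp add: parent_tree_def)
    show "inj_on \<phi> (vertices ?T)" using inj_\<phi> by (simp add: VT)
    show "vertices S = \<phi> ` vertices ?T \<union> \<Union>{inner_vertices (P x y) |x y. {x, y} \<in> edges ?T}"
      by (simp add: S_def VT)
    show "edges S = \<Union>{path_edges (P x y) |x y. {x, y} \<in> edges ?T}" by (simp add: S_def)
    fix x y assume e: "{x, y} \<in> edges ?T"
    obtain m where m: "{x, y} = {p m, Suc m}"
      "x = p m \<and> y = Suc m \<and> P x y = Q m \<and> P y x = rev (Q m) \<or>
       y = p m \<and> x = Suc m \<and> P x y = rev (Q m) \<and> P y x = Q m" using edge_cases[OF e] by blast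
    show "graph_path S (P x y)" using m(2) Q_path Q_path' by auto
    show "hd (P x y) = \<phi> x" using m(2) hd_Q last_Q Q_ne by (auto simp: hd_rev)
    show "last (P x y) = \<phi> y" using m(2) hd_Q last_Q Q_ne by (auto simp: last_rev)
    show "P y x = rev (P x y)" using m(2) by auto
    show "inner_vertices (P x y) \<inter> \<phi> ` vertices ?T = {}"
      using m(2) inner_\<phi>[of m] by (auto simp: inner_vertices_rev VT)
  next
    fix x y x' y'
    assume e: "{x, y} \<in> edges ?T \<and> {x', y'} \<in> edges ?T \<and> {x, y} \<noteq> {x', y'}"
    obtain m where m: "{x, y} = {p m, Suc m}" "P x y = Q m \<or> P x y = rev (Q m)"
      using edge_cases[of x y] e by blast
    obtain m' where m': "{x', y'} = {p m', Suc m'}" "P x' y' = Q m' \<or> P x' y' = rev (Q m')"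
      using edge_cases[of x' y'] e by blast
    have "m \<noteq> m'" using e m(1) m'(1) by blast
    then show "inner_vertices (P x y) \<inter> inner_vertices (P x' y') = {}"
      using m(2) m'(2) inner_disj[of m m'] by (auto simp: inner_vertices_rev)
  qed
  ultimately show ?thesis using T unfolding contains_subdivision_def by blast
qed

end

section \<open>Labellings by initial segments\<close>

lemma ball_type_isoI:
  assumes "is_graph G" "v \<in> vertices G" "graph_iso g G G'" "is_graph G'" "g v = v'"
  shows "ball_type G v r = ball_type G' v' r"
  using rooted_isomorphic_ball[OF assms(1-4)] ball_type_eq_iff[of G v r G' v' r] assms
  by (auto simp: is_graph_def)

text \<open>Rooted isomorphisms restrict to concentric smaller balls. This is what makes ancestors
  in the tree of balls well defined.\<close>

lemma ball_type_mono:
  assumes "is_graph G" "v \<in> vertices G" "is_graph G'" "v' \<in> vertices G'"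
    and "ball_type G v r = ball_type G' v' r" "s \<le> r"
  shows "ball_type G v s = ball_type G' v' s"
proof -
  have sG: "simple_graph G" using assms by (simp add: is_graph_def)
  obtain f where f: "graph_iso f (graph_ball G v r) (graph_ball G' v' r)" "f v = v'"
    using assms(5) unfolding ball_type_eq_iff[OF sG assms(2)] rooted_isomorphic_def by blast
  have "graph_iso f (graph_ball G v s) (graph_ball G' v' s)"
    by (rule graph_iso_ball_mono[OF assms(1-4) f assms(6)])
  then show ?thesis
    unfolding ball_type_eq_iff[OF sG assms(2)] rooted_isomorphic_def
    using f(2) assms(1-4) root_in_reach by (auto simp: vertices_graph_ball)
qed

lemma ball_type_cong:
  "graph_ball G v r = graph_ball G' v r \<Longrightarrow> ball_type G v r = ball_type G' v r"
  by (simp add: ball_type_def)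

lemma fst_ball_type [simp]: "fst (ball_type G v r) = r"
  by (simp add: ball_type_def)

section \<open>Transport of a graph along an injection\<close>

definition relabel :: "('a \<Rightarrow> 'b) \<Rightarrow> 'a sgraph \<Rightarrow> 'b sgraph" where
  "relabel g G = \<lparr>vertices = g ` vertices G, edges = (`) g ` edges G\<rparr>"

lemma relabel_edge_iff:
  assumes "simple_graph G" "inj_on g (vertices G)" "u \<in> vertices G" "v \<in> vertices G"
  shows "{g u, g v} \<in> edges (relabel g G) \<longleftrightarrow> {u, v} \<in> edges G"
proof
  assume "{g u, g v} \<in> edges (relabel g G)"
  then obtain e where e: "e \<in> edges G" "g ` e = g ` {u, v}" by (auto simp: relabel_def)
  then have "e \<subseteq> vertices G" using assms(1) by (auto simp: simple_graph_def)
  then have "e = {u, v}" using e(2) assms by (metis inj_on_image_eq_iff empty_subsetI insert_subset)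
  then show "{u, v} \<in> edges G" using e by simp
next
  assume "{u, v} \<in> edges G"
  then show "{g u, g v} \<in> edges (relabel g G)" by (auto simp: relabel_def intro: rev_image_eqI)
qed

lemma graph_iso_relabel:
  assumes "simple_graph G" "inj_on g (vertices G)"
  shows "graph_iso g G (relabel g G)"
  using assms relabel_edge_iff[OF assms]
  by (auto simp: graph_iso_def bij_betw_def relabel_def)

lemma simple_graph_relabel:
  assumes "simple_graph G" "inj_on g (vertices G)"
  shows "simple_graph (relabel g G)"
  unfolding simple_graph_def
proof
  fix e assume "e \<in> edges (relabel g G)"
  then obtain e' where e': "e' \<in> edges G" "e = g ` e'" by (auto simp: relabel_def)
  then obtain u v where "u \<in> vertices G" "v \<in> vertices G" "u \<noteq> v" "e' = {u, v}"
    using assms(1) by (auto simp: simple_graph_def)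
  then show "\<exists>u\<in>vertices (relabel g G). \<exists>v\<in>vertices (relabel g G). u \<noteq> v \<and> e = {u, v}"
    using assms(2) e' by (auto simp: relabel_def inj_on_eq_iff)
qed

lemma locally_finite_relabel:
  assumes "simple_graph G" "inj_on g (vertices G)" "locally_finite G"
  shows "locally_finite (relabel g G)"
  unfolding locally_finite_def
proof
  fix w assume "w \<in> vertices (relabel g G)"
  then obtain v where v: "v \<in> vertices G" "w = g v" by (auto simp: relabel_def)
  have "neighbours (relabel g G) w \<subseteq> g ` neighbours G v"
  proof
    fix x assume x: "x \<in> neighbours (relabel g G) w"
    then have "{w, x} \<in> edges (relabel g G)" by (simp add: neighbours_def)
    then have "x \<in> vertices (relabel g G)"
      using simple_graph_edgeD simple_graph_relabel assms by metis
    then obtain u where u: "u \<in> vertices G" "x = g u" by (auto simp: relabel_def)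
    then have "{v, u} \<in> edges G"
      using x v relabel_edge_iff[OF assms(1,2)] by (auto simp: neighbours_def)
    then show "x \<in> g ` neighbours G v" using u by (auto simp: neighbours_def)
  qed
  then show "finite (neighbours (relabel g G) w)"
    using assms(3) v by (meson finite_imageI finite_subset locally_finite_def)
qed

lemma is_graph_relabel:
  assumes "is_graph G" "inj_on g (vertices G)"
  shows "is_graph (relabel g G)"
proof -
  have s: "simple_graph G" "simple_graph (relabel g G)"
    using assms simple_graph_relabel by (auto simp: is_graph_def)
  obtain v where v: "v \<in> vertices G" using assms by (auto simp: is_graph_def graph_connected_def)
  have "graph_connected (relabel g G)"
  proof (rule graph_connectedI[OF s(2)])
    show "g v \<in> vertices (relabel g G)" using v by (simp add: relabel_def)
    fix u assume "u \<in> vertices (relabel g G)"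
    then obtain u' where u': "u' \<in> vertices G" "u = g u'" by (auto simp: relabel_def)
    obtain r where r: "u' \<in> reach G v r" using ex_reach[OF assms(1) v u'(1)] by blast
    have "g ` reach G v r \<subseteq> reach (relabel g G) (g v) r"
      by (rule reach_image_subset[OF _ order_refl]) (auto simp: relabel_def intro: rev_image_eqI)
    then show "\<exists>r. u \<in> reach (relabel g G) (g v) r" using r u' by blast
  qed
  then show ?thesis using s assms by (auto simp: is_graph_def relabel_def)
qed

text \<open>Vertices are ranked by distance from \<open>v\<close>, with ties broken by
  \<open>e\<close>. Whatever precedes a vertex of a ball lies in the same ball, which is finite; so
  ranks are finite and the ball is mapped injectively into an initial segment of its own size. The
  tie-breaker is left free so that it can reproduce a given numbering.\<close>

lemma layer_numbering:
  assumes G: "is_graph G" "locally_finite G" "v \<in> vertices G"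
    and inj: "inj_on e (vertices G)"
  defines "d \<equiv> graph_dist G v"
  defines "rk \<equiv> \<lambda>x. card {y \<in> vertices G. d y < d x \<or> d y = d x \<and> e y < (e x :: nat)}"
  shows "inj_on rk (vertices G)" "rk ` reach G v r = {..<card (reach G v r)}"
proof -
  let ?lt = "\<lambda>y x. d y < d x \<or> d y = d x \<and> e y < e x"
  let ?below = "\<lambda>x. {y \<in> vertices G. ?lt y x}"
  have s: "simple_graph G" using G by (simp add: is_graph_def)
  have reach: "y \<in> reach G v r \<longleftrightarrow> d y \<le> r" if "y \<in> vertices G" for y r
    using graph_dist_le_iff[OF G(1,3) that] by (simp add: d_def)
  have sub: "reach G v r \<subseteq> vertices G" for r using reach_subset_vertices[OF s G(3)] .
  have fin: "finite (reach G v r)" for r using finite_reach[OF s G(2,3)] .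
  have below: "?below x \<subset> reach G v r" if x: "x \<in> reach G v r" for x r
  proof -
    have "d x \<le> r" using x reach sub by blast
    then have "?below x \<subseteq> reach G v r" using reach by auto
    moreover have "x \<notin> ?below x" by simp
    ultimately show ?thesis using x by blast
  qed
  have less: "rk y < rk x" if "x \<in> vertices G" "y \<in> vertices G" "?lt y x" for x y
  proof -
    have "x \<in> reach G v (d x)" using reach that by simp
    then have "finite (?below x)" using below[of x "d x"] fin[of "d x"] by (blast intro: finite_subset)
    moreover have "?below y \<subseteq> ?below x" using that by auto
    then have "?below y \<subset> ?below x" using that by blast
    ultimately show ?thesis unfolding rk_def by (rule psubset_card_mono)
  qed
  show inj_rk: "inj_on rk (vertices G)"
  proof (rule inj_onI)
    fix x y assume xy: "x \<in> vertices G" "y \<in> vertices G" "rk x = rk y"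
    then have "\<not> ?lt x y" "\<not> ?lt y x" using less[of x y] less[of y x] by auto
    then have "e x = e y" by auto
    then show "x = y" using inj xy by (auto dest: inj_onD)
  qed
  have "rk ` reach G v r \<subseteq> {..<card (reach G v r)}"
    unfolding rk_def using psubset_card_mono[OF fin below] by blast
  then show "rk ` reach G v r = {..<card (reach G v r)}"
    using inj_on_subset[OF inj_rk sub] by (intro card_subset_eq) (auto simp: card_image)
qed

text \<open>Balls being initial segments, each ball type has only finitely many labelled representatives.\<close>

definition labelled :: "nat sgraph \<Rightarrow> bool" where
  "labelled G \<longleftrightarrow> is_graph G \<and> 0 \<in> vertices G \<and> (\<forall>r. \<exists>n. reach G 0 r = {..<n})"

text \<open>Rank \<open>G\<close> by distance and break ties by the labels carried over from
  \<open>C\<close> along \<open>f\<close>. As balls of \<open>C\<close> are initial segments, its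
  labels already grow with the distance, so inside the \<open>r\<close>-ball the ranks are exactly
  the old labels.\<close>

lemma extend_labelling:
  assumes C: "labelled C" and G: "is_graph G" "locally_finite G" "v \<in> vertices G"
    and f: "graph_iso f (graph_ball C 0 r) (graph_ball G v r)" "f 0 = v"
  obtains g where "labelled (relabel g G)" "inj_on g (vertices G)" "g v = 0"
    "graph_ball (relabel g G) 0 r = graph_ball C 0 r"
proof -
  have s: "simple_graph G" using G by (simp add: is_graph_def)
  have C': "is_graph C" "0 \<in> vertices C" using C by (auto simp: labelled_def)
  have bij: "bij_betw f (reach C 0 r) (reach G v r)"
    using f C' G by (simp add: graph_iso_def vertices_graph_ball)
  obtain n where n: "reach C 0 r = {..<n}" using C by (auto simp: labelled_def)
  let ?h = "inv_into {..<n} f"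
  have h: "bij_betw ?h (reach G v r) {..<n}" using bij_betw_inv_into[OF bij] n by simp
  have hf: "?h (f i) = i" if "i < n" for i using bij that n by (simp add: bij_betw_inv_into_left)
  \<comment> \<open>Inside the ball the labels of \<open>C\<close>, all below \<open>n\<close>;
    outside any injective numbering, shifted by \<open>n\<close> to avoid a clash.\<close>
  define e where "e x = (if x \<in> reach G v r then ?h x else n + to_nat_on (vertices G) x)" for x
  have hn: "?h x < n" if "x \<in> reach G v r" for x using bij_betw_apply[OF h that] by simp
  have inj_e: "inj_on e (vertices G)"
  proof (rule inj_onI)
    fix x y assume xy: "x \<in> vertices G" "y \<in> vertices G" "e x = e y"
    have "inj_on (to_nat_on (vertices G)) (vertices G)" using G by (auto simp: is_graph_def)
    then show "x = y" using xy h hn[of x] hn[of y]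
      by (auto simp: e_def bij_betw_def inj_on_eq_iff split: if_splits)
  qed
  define d where "d = graph_dist G v"
  define g where "g x = card {y \<in> vertices G. d y < d x \<or> d y = d x \<and> e y < e x}" for x
  note num = layer_numbering[OF G inj_e, folded d_def, folded g_def]
  have reach: "y \<in> reach G v r \<longleftrightarrow> d y \<le> r" if "y \<in> vertices G" for y r
    using graph_dist_le_iff[OF G(1,3) that] by (simp add: d_def)
  have le: "y \<in> vertices G" "d y \<le> q" if "y \<in> reach G v q" for y q
    using that reach_subset_vertices[OF s G(3), of q] reach[of y q] by (blast, blast)
  have gf: "g (f i) = i" if i: "i < n" for i
  proof -
    have fi: "f i \<in> reach G v r" using bij_betw_apply[OF bij] i n by simp
    have im: "f ` reach C 0 s = reach G v s" if "s \<le> r" for s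
      by (rule graph_iso_ball_reach[OF C' G(1,3) f that])
    \<comment> \<open>The ball of \<open>C\<close> whose radius is the distance of
      \<open>f k\<close> contains \<open>k\<close> and is an initial segment, hence contains
      \<open>j\<close> too.\<close>
    have mono: "d (f j) \<le> d (f k)" if "j < k" "k < n" for j k
    proof -
      have "f k \<in> reach G v r" using bij_betw_apply[OF bij] n that by simp
      then have k: "f k \<in> reach G v (d (f k))" "d (f k) \<le> r"
        using le[of "f k" r] reach[of "f k" "d (f k)"] by simp_all
      then have "f k \<in> f ` reach C 0 (d (f k))" using im by simp
      then obtain k' where k': "f k = f k'" "k' \<in> reach C 0 (d (f k))" by (rule imageE)
      have "k' \<in> reach C 0 r" using k'(2) reach_mono[OF k(2), of C 0] by blast
      then have "k' = k" using k'(1) hf[of k'] hf[of k] that(2) n by simp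
      moreover obtain m where "reach C 0 (d (f k)) = {..<m}" using C by (auto simp: labelled_def)
      ultimately have "j \<in> reach C 0 (d (f k))" using k'(2) that by simp
      then have "f j \<in> reach G v (d (f k))" using im[OF k(2)] by blast
      then show ?thesis by (rule le(2))
    qed
    \<comment> \<open>Exactly the images of the smaller labels precede \<open>f i\<close>, so its
      rank is \<open>i\<close>.\<close>
    have "{y \<in> vertices G. d y < d (f i) \<or> d y = d (f i) \<and> e y < e (f i)} = f ` {..<i}"
    proof (intro set_eqI iffI)
      fix y assume y: "y \<in> {y \<in> vertices G. d y < d (f i) \<or> d y = d (f i) \<and> e y < e (f i)}"
      have "d (f i) \<le> r" by (rule le(2)[OF fi])
      then have yr: "y \<in> reach G v r" using y reach[of y r] by auto
      then have "y \<in> f ` {..<n}" using bij n by (simp add: bij_betw_def)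
      then obtain j where j: "j < n" "y = f j" by auto
      have "j < i"
      proof (rule ccontr)
        assume "\<not> j < i"
        then have "i = j \<or> i < j" by auto
        moreover have "e (f i) = i" "e (f j) = j"
          using fi yr j hf[OF i] hf[OF j(1)] by (simp_all add: e_def)
        ultimately show False using y j mono[of i j] by auto
      qed
      then show "y \<in> f ` {..<i}" using j by blast
    next
      fix y assume "y \<in> f ` {..<i}"
      then obtain j where j: "j < i" "y = f j" by blast
      have fj: "f j \<in> reach G v r" using bij_betw_apply[OF bij] i j n by simp
      then have "e (f i) = i" "e (f j) = j" using fi j hf[of i] hf[of j] i by (simp_all add: e_def)
      then show "y \<in> {y \<in> vertices G. d y < d (f i) \<or> d y = d (f i) \<and> e y < e (f i)}"
        using mono[OF j(1) i] j le(1)[OF fj] by auto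
    qed
    moreover have "inj_on f {..<n}" using bij n by (simp add: bij_betw_def)
    then have "inj_on f {..<i}" using i by (auto intro: inj_on_subset)
    ultimately show "g (f i) = i" by (simp add: g_def card_image)
  qed
  have "0 < n" using root_in_reach[of 0 C r] n by simp
  then have gv: "g v = 0" using gf[of 0] f(2) by simp
  let ?G = "relabel g G"
  have G': "is_graph ?G" using is_graph_relabel[OF G(1) num(1)] .
  have v': "0 \<in> vertices ?G" using gv G by (auto simp: relabel_def intro: rev_image_eqI)
  have im: "reach ?G 0 s = g ` reach G v s" for s
  proof -
    have "g ` reach G v s \<subseteq> reach ?G 0 s"
      using reach_image_subset[of G v s g ?G s] gv
      by (auto simp: relabel_def intro: rev_image_eqI)
    moreover have "reach ?G 0 s \<subseteq> g ` reach G v s"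
    proof (induction s)
      case (Suc s)
      have "y \<in> g ` reach G v (Suc s)" if x: "x \<in> reach ?G 0 s" "{x, y} \<in> edges ?G" for x y
      proof -
        obtain x' where x': "x' \<in> reach G v s" "x = g x'" using Suc x by blast
        have "y \<in> vertices ?G"
          using simple_graph_edgeD(2)[OF _ x(2)] G' by (simp add: is_graph_def)
        then obtain y' where y': "y' \<in> vertices G" "y = g y'" by (auto simp: relabel_def)
        have "{x', y'} \<in> edges G"
          using x(2) x' y' relabel_edge_iff[OF s num(1) le(1)[OF x'(1)] y'(1)] by simp
        then show ?thesis using x' y' by auto
      qed
      then show ?case using Suc by auto
    qed (use gv in auto)
    ultimately show ?thesis by blast
  qed
  have lab: "labelled ?G" using G' v' im num(2) by (auto simp: labelled_def)
  have "reach ?G 0 r = (\<lambda>i. g (f i)) ` {..<n}"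
    using bij n by (simp add: im bij_betw_def flip: image_image)
  then have reach_eq: "reach ?G 0 r = reach C 0 r" using gf n by simp
  have "graph_ball ?G 0 r = graph_ball C 0 r"
  proof (rule simple_graph_eqI)
    fix a b
    have "{a, b} \<in> edges ?G \<longleftrightarrow> {a, b} \<in> edges C" if "a \<in> reach C 0 r" "b \<in> reach C 0 r"
    proof -
      have ab: "a < n" "b < n" using that n by auto
      have fab: "f a \<in> reach G v r" "f b \<in> reach G v r" using bij_betw_apply[OF bij] that by blast+
      then have "{f a, f b} \<in> edges G \<longleftrightarrow> {a, b} \<in> edges ?G"
        using relabel_edge_iff[OF s num(1) le(1)[OF fab(1)] le(1)[OF fab(2)]] gf[OF ab(1)] gf[OF ab(2)]
        by simp
      moreover have "{a, b} \<in> edges C \<longleftrightarrow> {f a, f b} \<in> edges G"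
        using f(1) that fab
        unfolding graph_iso_def edges_graph_ball[OF C'] edges_graph_ball[OF G(1,3)]
          vertices_graph_ball[OF C'] by blast
      ultimately show ?thesis by blast
    qed
    then show "{a, b} \<in> edges (graph_ball ?G 0 r) \<longleftrightarrow> {a, b} \<in> edges (graph_ball C 0 r)"
      unfolding edges_graph_ball[OF C'] edges_graph_ball[OF G' v'] reach_eq by blast
  qed (use G' v' C' reach_eq in \<open>auto simp: vertices_graph_ball is_graph_def intro: simple_graph_ball\<close>)
  then show ?thesis using that lab num(1) gv by blast
qed

section \<open>Limits of rays\<close>

text \<open>Without loops a ball of radius 0 is a single vertex and no edge. Hence the tree of balls
  has one root, which occurs in every member of the class.\<close>

lemma ball_type_0:
  assumes "is_graph G" "v \<in> vertices G" "is_graph G'" "v' \<in> vertices G'"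
  shows "ball_type G v 0 = ball_type G' v' 0"
proof -
  have "simple_graph G" "simple_graph G'" using assms by (auto simp: is_graph_def)
  then have "{v} \<notin> edges G" "{v'} \<notin> edges G'"
    using simple_graph_edgeD(3)[of G v v] simple_graph_edgeD(3)[of G' v' v'] by auto
  then have "graph_iso (\<lambda>_. v') (graph_ball G v 0) (graph_ball G' v' 0)"
    using assms by (simp add: graph_iso_def graph_ball_eq induced_on_def bij_betw_def)
  then show ?thesis using assms \<open>simple_graph G\<close>
    by (auto simp: ball_type_eq_iff rooted_isomorphic_def vertices_graph_ball)
qed

text \<open>A type is only an isomorphism class, so some graph realising it is chosen and its
  smaller ball taken; by \<open>ball_type_mono\<close> the choice does not matter. This is the
  ancestor function of the tree of balls.\<close>

definition restrict_type :: "nat \<times> (nat sgraph \<times> nat) set \<Rightarrow> nat \<Rightarrow> nat \<times> (nat sgraph \<times> nat) set" where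
  "restrict_type t s = (SOME t'. \<exists>G v. is_graph G \<and> v \<in> vertices G \<and>
    ball_type G v (fst t) = t \<and> t' = ball_type G v s)"

lemma restrict_type_eq:
  assumes "is_graph G" "v \<in> vertices G" "s \<le> r"
  shows "restrict_type (ball_type G v r) s = ball_type G v s"
  unfolding restrict_type_def
proof (rule someI2)
  show "\<exists>G' v'. is_graph G' \<and> v' \<in> vertices G' \<and>
    ball_type G' v' (fst (ball_type G v r)) = ball_type G v r \<and> ball_type G v s = ball_type G' v' s"
    using assms by auto
next
  fix t assume "\<exists>G' v'. is_graph G' \<and> v' \<in> vertices G' \<and>
    ball_type G' v' (fst (ball_type G v r)) = ball_type G v r \<and> t = ball_type G' v' s"
  then show "t = ball_type G v s" using ball_type_mono[OF _ _ assms(1,2) _ assms(3)] by force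
qed

locale locally_finite_class =
  fixes \<G> :: "nat sgraph set"
  assumes closed_under_iso: "graph_class \<G>" and lf: "G \<in> \<G> \<Longrightarrow> locally_finite G"
begin

lemma is_graph: "G \<in> \<G> \<Longrightarrow> is_graph G"
  using closed_under_iso by (simp add: graph_class_def)

lemma iso_closed:
  assumes "G \<in> \<G>" "is_graph G'" "graph_iso f G G'"
  shows "G' \<in> \<G>"
proof -
  have "isomorphic G G'" using assms(3) unfolding isomorphic_def by blast
  then show ?thesis using closed_under_iso assms(1,2) unfolding graph_class_def by blast
qed

lemma ball_types_cases:
  assumes "t \<in> ball_types \<G>" "fst t = r"
  obtains G v where "G \<in> \<G>" "v \<in> vertices G" "t = ball_type G v r"
  using assms by (auto simp: ball_types_def)

lemma extend_labelled:
  assumes C: "labelled C" and G: "G \<in> \<G>" "v \<in> vertices G"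
    and eq: "ball_type C 0 r = ball_type G v r"
  obtains g where "relabel g G \<in> \<G>" "labelled (relabel g G)" "inj_on g (vertices G)"
    "\<And>s. ball_type (relabel g G) 0 s = ball_type G v s"
    "graph_ball (relabel g G) 0 r = graph_ball C 0 r"
proof -
  have C': "simple_graph C" "0 \<in> vertices C" using C by (auto simp: labelled_def is_graph_def)
  obtain f where "graph_iso f (graph_ball C 0 r) (graph_ball G v r)" "f 0 = v"
    using eq unfolding ball_type_eq_iff[OF C'] rooted_isomorphic_def by blast
  then obtain g where g: "labelled (relabel g G)" "inj_on g (vertices G)" "g v = 0"
    "graph_ball (relabel g G) 0 r = graph_ball C 0 r"
    by (rule extend_labelling[OF C is_graph[OF G(1)] lf[OF G(1)] G(2)])
  have iso: "graph_iso g G (relabel g G)"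
    using graph_iso_relabel g is_graph[OF G(1)] by (auto simp: is_graph_def)
  have rel: "is_graph (relabel g G)" using g by (simp add: labelled_def)
  have "relabel g G \<in> \<G>" by (rule iso_closed[OF G(1) rel iso])
  moreover have "ball_type (relabel g G) 0 s = ball_type G v s" for s
    by (rule ball_type_isoI[OF is_graph[OF G(1)] G(2) iso rel g(3), symmetric])
  ultimately show ?thesis using that g by blast
qed

lemma ex_labelled:
  assumes G: "G \<in> \<G>" "v \<in> vertices G"
  obtains g where "relabel g G \<in> \<G>" "labelled (relabel g G)" "inj_on g (vertices G)"
    "\<And>s. ball_type (relabel g G) 0 s = ball_type G v s"
proof -
  \<comment> \<open>The one-vertex graph has the same 0-ball as every graph, so extending its
    trivial labelling labels an arbitrary graph from scratch.\<close>
  let ?C = "\<lparr>vertices = {0}, edges = {}\<rparr> :: nat sgraph"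
  have "reach ?C 0 r = {..<1}" for r by (induction r) auto
  moreover have "simple_graph ?C" by (simp add: simple_graph_def)
  moreover have "graph_connected ?C"
    by (rule graph_connectedI[of _ 0]) (auto simp: simple_graph_def intro: root_in_reach)
  ultimately have C: "labelled ?C" by (auto simp: labelled_def is_graph_def)
  then have "ball_type ?C 0 0 = ball_type G v 0"
    using ball_type_0 is_graph G by (auto simp: labelled_def)
  from extend_labelled[OF C G this] show ?thesis using that by blast
qed

end

locale closed_locally_finite_class = locally_finite_class +
  assumes closed: "closed_class \<G>"
begin

text \<open>Labelled members \<open>F n\<close> realising \<open>t n\<close> are chosen so that each
  agrees literally with the next one on the ball of radius \<open>n\<close>. The balls of their
  union about 0 are those of the \<open>F n\<close>, and every ball about another vertex already
  occurs in some \<open>F n\<close>; closedness then puts the union into the class.\<close>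

lemma ray_limit:
  assumes t: "\<And>r. t r \<in> ball_types \<G>" "\<And>r. fst (t r) = r" "\<And>r. restrict_type (t (Suc r)) r = t r"
  obtains G v where "G \<in> \<G>" "v \<in> vertices G" "\<And>r. ball_type G v r = t r"
proof -
  have "\<exists>F. \<forall>n. (F n \<in> \<G> \<and> labelled (F n) \<and> ball_type (F n) 0 n = t n) \<and>
    graph_ball (F (Suc n)) 0 n = graph_ball (F n) 0 n"
  proof (rule dependent_nat_choice)
    obtain G v where G: "G \<in> \<G>" "v \<in> vertices G" "t 0 = ball_type G v 0"
      using ball_types_cases[OF t(1) t(2)] by blast
    obtain g where "relabel g G \<in> \<G>" "labelled (relabel g G)" "ball_type (relabel g G) 0 0 = ball_type G v 0"
      using ex_labelled[OF G(1,2)] by blast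
    then show "\<exists>G. G \<in> \<G> \<and> labelled G \<and> ball_type G 0 0 = t 0" using G(3) by auto
  next
    fix C n assume C: "C \<in> \<G> \<and> labelled C \<and> ball_type C 0 n = t n"
    obtain G v where G: "G \<in> \<G>" "v \<in> vertices G" "t (Suc n) = ball_type G v (Suc n)"
      using ball_types_cases[OF t(1) t(2)] by blast
    then have "ball_type C 0 n = ball_type G v n"
      using t(3)[of n] restrict_type_eq[OF is_graph[OF G(1)] G(2), of n "Suc n"] C by simp
    then obtain g where "relabel g G \<in> \<G>" "labelled (relabel g G)"
      "ball_type (relabel g G) 0 (Suc n) = ball_type G v (Suc n)"
      "graph_ball (relabel g G) 0 n = graph_ball C 0 n"
      using extend_labelled[OF _ G(1,2)] C by blast
    then show "\<exists>G. (G \<in> \<G> \<and> labelled G \<and> ball_type G 0 (Suc n) = t (Suc n)) \<and>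
        graph_ball G 0 n = graph_ball C 0 n"
      using G(3) by auto
  qed
  then obtain F where F: "\<And>n. F n \<in> \<G>" "\<And>n. labelled (F n)" "\<And>n. ball_type (F n) 0 n = t n"
      "\<And>n. graph_ball (F (Suc n)) 0 n = graph_ball (F n) 0 n" by blast
  have F': "is_graph (F n)" "0 \<in> vertices (F n)" for n using F(2)[of n] by (auto simp: labelled_def)
  have ball: "graph_ball (F m) 0 n = graph_ball (F n) 0 n" if "n \<le> m" for m n
    using that
  proof (induction rule: dec_induct)
    case (step m)
    have "graph_ball (F (Suc m)) 0 n = graph_ball (F m) 0 n"
      by (rule graph_ball_cong[OF F' F' F(4), where s = 0]) (use step in auto)
    then show ?case using step by simp
  qed simp
  let ?R = "\<lambda>n. reach (F n) 0 n"
  have R: "reach (F m) 0 n = ?R n" if "n \<le> m" for m n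
    using arg_cong[OF ball[OF that], of vertices] F' by (simp add: vertices_graph_ball)
  have R_mono: "?R n \<subseteq> ?R m" if "n \<le> m" for n m
    using R[OF that] reach_mono[OF that, of "F m" 0] by simp
  \<comment> \<open>Only the ball of radius \<open>n\<close> is taken from \<open>F n\<close>:
    beyond it, later graphs may disagree.\<close>
  let ?L = "\<lparr>vertices = \<Union>n. ?R n, edges = \<Union>n. edges (graph_ball (F n) 0 n)\<rparr>"
  have L_edge: "{a, b} \<in> edges ?L \<longleftrightarrow> (\<exists>n. {a, b} \<in> edges (F n) \<and> a \<in> ?R n \<and> b \<in> ?R n)" for a b
    using F' by (simp add: edges_graph_ball)
  have edge_mono: "{a, b} \<in> edges (F n) \<longleftrightarrow> {a, b} \<in> edges (F m)"
    if "n \<le> m" "a \<in> ?R n" "b \<in> ?R n" for a b n m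
  proof -
    have "{a, b} \<in> edges (graph_ball (F n) 0 n) \<longleftrightarrow> {a, b} \<in> edges (graph_ball (F m) 0 n)"
      using ball[OF that(1)] by simp
    then show ?thesis using that R[OF that(1)] unfolding edges_graph_ball[OF F'] by simp
  qed
  have edge: "{a, b} \<in> edges ?L \<longleftrightarrow> {a, b} \<in> edges (F n)" if "a \<in> ?R n" "b \<in> ?R n" for a b n
  proof
    assume "{a, b} \<in> edges ?L"
    then obtain k where k: "{a, b} \<in> edges (F k)" "a \<in> ?R k" "b \<in> ?R k" unfolding L_edge by blast
    then have "{a, b} \<in> edges (F (max k n))" using edge_mono[of k "max k n" a b] by simp
    then show "{a, b} \<in> edges (F n)" using edge_mono[of n "max k n" a b] that by simp
  qed (use that L_edge in blast)
  have simple: "simple_graph ?L"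
    unfolding simple_graph_def
  proof
    fix e assume "e \<in> edges ?L"
    then obtain n where n: "e \<in> edges (graph_ball (F n) 0 n)" by auto
    have "simple_graph (graph_ball (F n) 0 n)" using F'[of n] simple_graph_ball by (auto simp: is_graph_def)
    then obtain u v where "u \<in> ?R n" "v \<in> ?R n" "u \<noteq> v" "e = {u, v}"
      using n F'[of n] by (auto simp: simple_graph_def vertices_graph_ball)
    then show "\<exists>u\<in>vertices ?L. \<exists>v\<in>vertices ?L. u \<noteq> v \<and> e = {u, v}" by auto
  qed
  have reach: "reach ?L 0 n = ?R n" for n
  proof (induction n)
    case (Suc n)
    show ?case
    proof (intro subset_antisym subsetI)
      fix y assume y: "y \<in> reach ?L 0 (Suc n)"
      show "y \<in> ?R (Suc n)"
      proof (cases "y \<in> reach ?L 0 n")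
        case True
        then show ?thesis using Suc R_mono[of n "Suc n"] by auto
      next
        case False
        then obtain x where x: "x \<in> ?R n" "{x, y} \<in> edges ?L" using y Suc.IH by auto
        then obtain k where k: "{x, y} \<in> edges (F k)" "x \<in> ?R k" "y \<in> ?R k" unfolding L_edge by blast
        let ?m = "max k (Suc n)"
        have "{x, y} \<in> edges (F ?m)" using edge_mono[of k ?m x y] k by simp
        moreover have "x \<in> reach (F ?m) 0 n" using x(1) R[of n ?m] by simp
        ultimately have "y \<in> reach (F ?m) 0 (Suc n)" by auto
        then show ?thesis using R[of "Suc n" ?m] by (simp del: reach.simps)
      qed
    next
      fix y assume y: "y \<in> ?R (Suc n)"
      have Rn: "reach (F (Suc n)) 0 n = ?R n" using R[of n "Suc n"] by simp
      show "y \<in> reach ?L 0 (Suc n)"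
      proof (cases "y \<in> ?R n")
        case True
        then show ?thesis using Suc by simp
      next
        case False
        then obtain x where x: "x \<in> ?R n" "{x, y} \<in> edges (F (Suc n))" using y Rn by auto
        moreover have "x \<in> ?R (Suc n)" using x(1) R_mono[of n "Suc n"] by auto
        ultimately have "{x, y} \<in> edges ?L" using y unfolding L_edge by blast
        then show ?thesis using x(1) Suc.IH by auto
      qed
    qed
  qed simp
  have "0 \<in> ?R 0" by simp
  then have zero: "0 \<in> vertices ?L" by (simp only: sgraph.select_convs) blast
  have "\<exists>n. u \<in> reach ?L 0 n" if "u \<in> vertices ?L" for u
    using that unfolding reach by (simp only: sgraph.select_convs) blast
  then have "graph_connected ?L" by (rule graph_connectedI[OF simple zero])
  then have L: "is_graph ?L" using simple by (simp add: is_graph_def)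
  have L_ball: "graph_ball ?L 0 n = graph_ball (F n) 0 n" for n
  proof (rule simple_graph_eqI)
    show "vertices (graph_ball ?L 0 n) = vertices (graph_ball (F n) 0 n)"
      using reach vertices_graph_ball[OF L zero] vertices_graph_ball[OF F'] by simp
    show "{a, b} \<in> edges (graph_ball ?L 0 n) \<longleftrightarrow> {a, b} \<in> edges (graph_ball (F n) 0 n)" for a b
      unfolding edges_graph_ball[OF L zero] edges_graph_ball[OF F'] reach using edge[of a n b] by blast
  qed (use simple F'[of n] in \<open>auto intro: simple_graph_ball simp: is_graph_def\<close>)
  have "?L \<in> \<G>"
  proof (rule ccontr)
    assume "?L \<notin> \<G>"
    then obtain v r where v: "v \<in> vertices ?L" "ball_type ?L v r \<notin> ball_types \<G>"
      using closed L unfolding closed_class_def by blast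
    then obtain s where s: "v \<in> ?R s" by (auto simp del: reach.simps)
    then have "v \<in> reach ?L 0 s" unfolding reach .
    \<comment> \<open>Since \<open>v\<close> is within distance \<open>s\<close> of 0, radius
      \<open>s + r\<close> about 0 covers the \<open>r\<close>-ball about \<open>v\<close>.\<close>
    then have "graph_ball ?L v r = graph_ball (F (s + r)) v r"
      by (rule graph_ball_cong[OF L zero F' L_ball]) simp
    then have "ball_type ?L v r = ball_type (F (s + r)) v r" by (rule ball_type_cong)
    moreover have "v \<in> vertices (F (s + r))"
      using R_mono[of s "s + r"] s reach_subset_vertices[of "F (s + r)" 0 "s + r"] F'[of "s + r"]
      by (auto simp: is_graph_def)
    ultimately show False using v(2) F(1) unfolding ball_types_def by blast
  qed
  moreover have "ball_type ?L 0 r = t r" for r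
    using ball_type_cong[OF L_ball] F(3) by simp
  ultimately show ?thesis using that zero by blast
qed

end

section \<open>Joint induced embeddings\<close>

lemma inj_sgraph_components: "inj (\<lambda>K :: 'a sgraph. (vertices K, edges K))"
  by (rule injI) (auto intro: sgraph.equality)

lemma finite_simple_graphs:
  assumes "finite A"
  shows "finite {K :: 'a sgraph. simple_graph K \<and> vertices K \<subseteq> A}"
proof -
  have "(\<lambda>K. (vertices K, edges K)) ` {K :: 'a sgraph. simple_graph K \<and> vertices K \<subseteq> A} \<subseteq> Pow A \<times> Pow (Pow A)"
    by (auto simp: simple_graph_def)
  then have "finite ((\<lambda>K. (vertices K, edges K)) ` {K :: 'a sgraph. simple_graph K \<and> vertices K \<subseteq> A})"
    by (rule finite_subset) (use assms in simp)
  then show ?thesis by (rule finite_imageD[OF _ inj_on_subset[OF inj_sgraph_components subset_UNIV]])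
qed

lemma countable_finite_simple_graphs:
  "countable {K :: nat sgraph. simple_graph K \<and> finite (vertices K)}"
proof -
  have "{K :: nat sgraph. simple_graph K \<and> finite (vertices K)} \<subseteq>
      (\<Union>n. {K. simple_graph K \<and> vertices K \<subseteq> {..<n}})"
    using finite_nat_bounded by blast
  moreover have "countable (\<Union>n. {K :: nat sgraph. simple_graph K \<and> vertices K \<subseteq> {..<n}})"
    by (intro countable_UN countableI_type countable_finite finite_simple_graphs finite_lessThan)
  ultimately show ?thesis by (rule countable_subset)
qed

definition induced_embedding :: "('a \<Rightarrow> 'b) \<Rightarrow> 'a sgraph \<Rightarrow> 'b sgraph \<Rightarrow> bool" where
  "induced_embedding f G H \<longleftrightarrow> inj_on f (vertices G) \<and> f ` vertices G \<subseteq> vertices H \<and>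
    (\<forall>u\<in>vertices G. \<forall>v\<in>vertices G. {u, v} \<in> edges G \<longleftrightarrow> {f u, f v} \<in> edges H)"

lemma induced_embedding_comp:
  "induced_embedding f G H \<Longrightarrow> induced_embedding g H K \<Longrightarrow> induced_embedding (g \<circ> f) G K"
  unfolding induced_embedding_def by (auto intro: comp_inj_on inj_on_subset simp: image_subset_iff)

lemma induced_embedding_relabel:
  "simple_graph G \<Longrightarrow> inj_on g (vertices G) \<Longrightarrow> induced_embedding g G (relabel g G)"
  by (simp add: induced_embedding_def relabel_edge_iff) (simp add: relabel_def)

lemma strongly_contains_iff:
  "strongly_contains H \<A> \<longleftrightarrow> (\<forall>G\<in>\<A>. \<exists>f. induced_embedding f G H)"
proof -
  have "(\<exists>S\<subseteq>vertices H. isomorphic G (induced_on H S)) \<longleftrightarrow> (\<exists>f. induced_embedding f G H)" for G :: "'b sgraph"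
  proof
    assume "\<exists>S\<subseteq>vertices H. isomorphic G (induced_on H S)"
    then obtain S f where S: "S \<subseteq> vertices H" "graph_iso f G (induced_on H S)"
      unfolding isomorphic_def by blast
    then have "inj_on f (vertices G)" "f ` vertices G = S"
      by (simp_all add: graph_iso_def induced_on_def bij_betw_def)
    then have "induced_embedding f G H"
      using S by (auto simp: graph_iso_def induced_on_def induced_embedding_def)
    then show "\<exists>f. induced_embedding f G H" by blast
  next
    assume "\<exists>f. induced_embedding f G H"
    then obtain f where f: "induced_embedding f G H" by blast
    then have "graph_iso f G (induced_on H (f ` vertices G))"
      by (auto simp: graph_iso_def induced_on_def induced_embedding_def bij_betw_def)
    then show "\<exists>S\<subseteq>vertices H. isomorphic G (induced_on H S)"
      using f unfolding induced_embedding_def isomorphic_def by blast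
  qed
  then show ?thesis by (simp add: strongly_contains_def)
qed

text \<open>Connectedness is not asked for, so that hosts can be combined by disjoint union.
  Vertices in \<nat> make the host countable and fix its type.\<close>

definition jointly_embeddable :: "nat sgraph set \<Rightarrow> bool" where
  "jointly_embeddable \<A> \<longleftrightarrow>
    (\<exists>H :: nat sgraph. simple_graph H \<and> locally_finite H \<and> (\<forall>G\<in>\<A>. \<exists>f. induced_embedding f G H))"

lemma jointly_embeddable_mono: "jointly_embeddable \<B> \<Longrightarrow> \<A> \<subseteq> \<B> \<Longrightarrow> jointly_embeddable \<A>"
  unfolding jointly_embeddable_def by blast

lemma jointly_embeddableI:
  fixes H :: "'b sgraph"
  assumes H: "simple_graph H" "locally_finite H" "countable (vertices H)"
    and emb: "\<And>G. G \<in> \<A> \<Longrightarrow> \<exists>f. induced_embedding f G H"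
  shows "jointly_embeddable \<A>"
  unfolding jointly_embeddable_def
proof -
  let ?g = "to_nat_on (vertices H)"
  have inj: "inj_on ?g (vertices H)" by (rule inj_on_to_nat_on[OF H(3)])
  have "simple_graph (relabel ?g H)" by (rule simple_graph_relabel[OF H(1) inj])
  moreover have "locally_finite (relabel ?g H)" by (rule locally_finite_relabel[OF H(1) inj H(2)])
  moreover have "\<forall>G\<in>\<A>. \<exists>f. induced_embedding f G (relabel ?g H)"
    using emb induced_embedding_comp[OF _ induced_embedding_relabel[OF H(1) inj]] by blast
  ultimately show "\<exists>H :: nat sgraph. simple_graph H \<and> locally_finite H \<and>
      (\<forall>G\<in>\<A>. \<exists>f. induced_embedding f G H)"
    by (intro exI[of _ "relabel ?g H"] conjI)
qed

text \<open>The disjoint union of the hosts, tagged by the sets they serve, has the same degrees and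
  is still countable.\<close>

lemma jointly_embeddable_Union:
  assumes "countable F" "\<And>\<A>. \<A> \<in> F \<Longrightarrow> jointly_embeddable \<A>"
  shows "jointly_embeddable (\<Union>F)"
proof -
  obtain H :: "nat sgraph set \<Rightarrow> nat sgraph" where
    H: "\<And>\<A>. \<A> \<in> F \<Longrightarrow> simple_graph (H \<A>)" "\<And>\<A>. \<A> \<in> F \<Longrightarrow> locally_finite (H \<A>)"
      "\<And>\<A> G. \<A> \<in> F \<Longrightarrow> G \<in> \<A> \<Longrightarrow> \<exists>f. induced_embedding f G (H \<A>)"
    using assms(2) unfolding jointly_embeddable_def by metis
  define L where "L = \<lparr>vertices = Sigma F (\<lambda>\<A>. vertices (H \<A>)),
    edges = {{(\<A>, x), (\<A>, y)} | \<A> x y. \<A> \<in> F \<and> {x, y} \<in> edges (H \<A>)}\<rparr>"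
  have edge: "{(\<A>, x), w} \<in> edges L \<longleftrightarrow> \<A> \<in> F \<and> (\<exists>y. w = (\<A>, y) \<and> {x, y} \<in> edges (H \<A>))" for \<A> x w
    by (auto simp: L_def doubleton_eq_iff insert_commute)
  show ?thesis
  proof (rule jointly_embeddableI)
    show "simple_graph L"
      unfolding simple_graph_def
    proof
      fix e assume "e \<in> edges L"
      then obtain \<A> x y where e: "e = {(\<A>, x), (\<A>, y)}" "\<A> \<in> F" "{x, y} \<in> edges (H \<A>)"
        by (auto simp: L_def)
      then show "\<exists>u\<in>vertices L. \<exists>v\<in>vertices L. u \<noteq> v \<and> e = {u, v}"
        using simple_graph_edgeD[OF H(1)[OF e(2)] e(3)]
        by (intro bexI[of _ "(\<A>, x)"] bexI[of _ "(\<A>, y)"]) (auto simp: L_def)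
    qed
    show "locally_finite L"
      unfolding locally_finite_def
    proof
      fix w assume "w \<in> vertices L"
      then obtain \<A> x where w: "w = (\<A>, x)" "\<A> \<in> F" "x \<in> vertices (H \<A>)" by (auto simp: L_def)
      have "neighbours L w \<subseteq> Pair \<A> ` neighbours (H \<A>) x"
        unfolding w neighbours_def edge by auto
      moreover have "finite (neighbours (H \<A>) x)" using H(2) w by (simp add: locally_finite_def)
      ultimately show "finite (neighbours L w)" by (meson finite_imageI finite_subset)
    qed
    show "countable (vertices L)" using assms(1) by (auto simp: L_def)
    fix G assume "G \<in> \<Union>F"
    then obtain \<A> f where f: "\<A> \<in> F" "induced_embedding f G (H \<A>)" using H(3) by blast
    then have "induced_embedding (Pair \<A>) (H \<A>) L"
      unfolding induced_embedding_def edge by (auto simp: L_def inj_on_def)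
    then show "\<exists>f. induced_embedding f G L" using f(2) induced_embedding_comp by blast
  qed
qed

lemma jointly_embeddable_imp_connected_host:
  assumes "jointly_embeddable \<A>"
  shows "\<exists>H :: nat sgraph. is_graph H \<and> locally_finite H \<and> strongly_contains H \<A>"
proof -
  obtain H :: "nat sgraph" where H: "simple_graph H" "locally_finite H"
    "\<And>G. G \<in> \<A> \<Longrightarrow> \<exists>f. induced_embedding f G H"
    using assms unfolding jointly_embeddable_def by blast
  \<comment> \<open>Attaching all vertices to a ray connects \<open>H\<close> and raises each degree by one only.\<close>
  define L :: "(nat + nat) sgraph" where "L = \<lparr>vertices = Inl ` vertices H \<union> range Inr,
    edges = {{Inl x, Inl y} | x y. {x, y} \<in> edges H} \<union> {{Inl x, Inr x} | x. x \<in> vertices H} \<union>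
      {{Inr n, Inr (Suc n)} | n. True}\<rparr>"
  have LL: "{Inl x, Inl y} \<in> edges L \<longleftrightarrow> {x, y} \<in> edges H" for x y
    by (auto simp: L_def doubleton_eq_iff insert_commute)
  have LR: "{Inl x, Inr n} \<in> edges L \<longleftrightarrow> x = n \<and> x \<in> vertices H" for x n
    by (auto simp: L_def doubleton_eq_iff)
  have RR: "{Inr m, Inr n} \<in> edges L \<longleftrightarrow> m = Suc n \<or> n = Suc m" for m n
    by (auto simp: L_def doubleton_eq_iff)
  have simple: "simple_graph L"
    unfolding simple_graph_def
  proof
    fix e assume "e \<in> edges L"
    then consider x y where "e = {Inl x, Inl y}" "{x, y} \<in> edges H" | x where "e = {Inl x, Inr x}" "x \<in> vertices H"
      | n where "e = {Inr n, Inr (Suc n)}" by (auto simp: L_def)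
    then show "\<exists>u\<in>vertices L. \<exists>v\<in>vertices L. u \<noteq> v \<and> e = {u, v}"
    proof cases
      case (1 x y)
      then show ?thesis using simple_graph_edgeD[OF H(1) 1(2)]
        by (intro bexI[of _ "Inl x"] bexI[of _ "Inl y"]) (auto simp: L_def)
    next
      case (2 x)
      then show ?thesis by (intro bexI[of _ "Inl x"] bexI[of _ "Inr x"]) (auto simp: L_def)
    next
      case (3 n)
      then show ?thesis by (intro bexI[of _ "Inr n"] bexI[of _ "Inr (Suc n)"]) (auto simp: L_def)
    qed
  qed
  have ray: "Inr n \<in> reach L (Inr 0) n" for n
  proof (induction n)
    case (Suc n)
    have "{Inr n, Inr (Suc n)} \<in> edges L" by (simp add: RR)
    then show ?case using Suc by auto
  qed simp
  have lower: "Inl x \<in> reach L (Inr 0) (Suc x)" if "x \<in> vertices H" for x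
  proof -
    have "{Inr x, Inl x} \<in> edges L" using LR[of x x] that by (simp add: insert_commute)
    then show ?thesis using ray[of x] by auto
  qed
  have "\<exists>r. u \<in> reach L (Inr 0) r" if "u \<in> vertices L" for u
    using that ray lower by (auto simp: L_def simp del: reach.simps)
  then have "graph_connected L"
    by (intro graph_connectedI[OF simple, of "Inr 0"]) (simp add: L_def)
  moreover have "countable (vertices L)" by (simp add: L_def)
  ultimately have L: "is_graph L" using simple by (simp add: is_graph_def)
  have L_lf: "locally_finite L"
    unfolding locally_finite_def
  proof
    fix w assume "w \<in> vertices L"
    show "finite (neighbours L w)"
    proof (cases w)
      case (Inl x)
      have "neighbours L w \<subseteq> insert (Inr x) (Inl ` neighbours H x)"
      proof
        fix z assume "z \<in> neighbours L w"
        then show "z \<in> insert (Inr x) (Inl ` neighbours H x)"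
          using Inl LL LR by (cases z) (auto simp: neighbours_def)
      qed
      moreover have "finite (neighbours H x)"
        using \<open>w \<in> vertices L\<close> Inl H(2) by (auto simp: L_def locally_finite_def)
      ultimately show ?thesis by (meson finite_imageI finite_insert finite_subset)
    next
      case (Inr n)
      have "neighbours L w \<subseteq> {Inl n, Inr (Suc n), Inr (n - 1)}"
      proof
        fix z assume "z \<in> neighbours L w"
        then show "z \<in> {Inl n, Inr (Suc n), Inr (n - 1)}"
          using Inr RR LR by (cases z) (auto simp: neighbours_def insert_commute)
      qed
      then show ?thesis by (rule finite_subset) simp
    qed
  qed
  let ?g = "to_nat_on (vertices L)"
  have inj: "inj_on ?g (vertices L)" using L by (intro inj_on_to_nat_on) (simp add: is_graph_def)
  have "induced_embedding Inl H L" using LL by (auto simp: induced_embedding_def L_def)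
  then have H_L: "induced_embedding (?g \<circ> Inl) H (relabel ?g L)"
    by (rule induced_embedding_comp[OF _ induced_embedding_relabel[OF simple inj]])
  have "strongly_contains (relabel ?g L) \<A>"
    unfolding strongly_contains_iff
  proof
    fix G assume "G \<in> \<A>"
    then obtain f where "induced_embedding f G H" using H(3) by blast
    then show "\<exists>f. induced_embedding f G (relabel ?g L)" using induced_embedding_comp[OF _ H_L] by blast
  qed
  then show ?thesis
    using is_graph_relabel[OF L inj] locally_finite_relabel[OF simple inj L_lf]
    by (intro exI[of _ "relabel ?g L"] conjI)
qed

section \<open>The tree of balls\<close>

context locally_finite_class
begin

sublocale ball_level_tree: level_tree "ball_types \<G>" fst restrict_type
proof
  fix t s assume t: "t \<in> ball_types \<G>" "s \<le> fst t"
  then obtain G v where G: "G \<in> \<G>" "v \<in> vertices G" "t = ball_type G v (fst t)"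
    using ball_types_cases[OF _ refl] by blast
  have eq: "restrict_type t s = ball_type G v s"
    using restrict_type_eq[OF is_graph[OF G(1)] G(2) t(2)] G(3) by simp
  then show "restrict_type t s \<in> ball_types \<G>" using G by (auto simp: ball_types_def)
  show "fst (restrict_type t s) = s" by (simp add: eq)
next
  fix t assume t: "t \<in> ball_types \<G>"
  then obtain G v where G: "G \<in> \<G>" "v \<in> vertices G" "t = ball_type G v (fst t)"
    using ball_types_cases[OF _ refl] by blast
  show "restrict_type t (fst t) = t"
    using restrict_type_eq[OF is_graph[OF G(1)] G(2) order_refl, of "fst t"] G(3) by simp
next
  fix t s s' assume t: "t \<in> ball_types \<G>" "s \<le> s'" "s' \<le> fst t"
  then obtain G v where G: "G \<in> \<G>" "v \<in> vertices G" "t = ball_type G v (fst t)"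
    using ball_types_cases[OF _ refl] by blast
  note eq = restrict_type_eq[OF is_graph[OF G(1)] G(2)]
  show "restrict_type (restrict_type t s') s = restrict_type t s"
    using eq[OF t(3)] eq[OF t(2)] eq[of s "fst t"] t G(3) by simp
qed

lemma restrict_ball_type:
  "G \<in> \<G> \<Longrightarrow> v \<in> vertices G \<Longrightarrow> s \<le> r \<Longrightarrow> restrict_type (ball_type G v r) s = ball_type G v s"
  by (rule restrict_type_eq[OF is_graph])

lemma ball_tree_eq: "ball_tree \<G> = ball_level_tree.tree"
proof -
  have "{{ball_type G v (r - 1), ball_type G v r} | G v r. G \<in> \<G> \<and> v \<in> vertices G \<and> r \<ge> 1} =
    {{restrict_type t (fst t - 1), t} | t. t \<in> ball_types \<G> \<and> fst t \<ge> 1}" (is "?A = ?B")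
  proof (intro subset_antisym subsetI)
    fix e assume "e \<in> ?A"
    then obtain G v r where e: "e = {ball_type G v (r - 1), ball_type G v r}" "G \<in> \<G>" "v \<in> vertices G" "r \<ge> 1"
      by blast
    then show "e \<in> ?B" using restrict_ball_type[OF e(2,3), of "r - 1" r]
      by (intro CollectI exI[of _ "ball_type G v r"]) (auto simp: ball_types_def)
  next
    fix e assume "e \<in> ?B"
    then obtain t where t: "e = {restrict_type t (fst t - 1), t}" "t \<in> ball_types \<G>" "fst t \<ge> 1" by blast
    then obtain G v where G: "G \<in> \<G>" "v \<in> vertices G" "t = ball_type G v (fst t)"
      using ball_types_cases[OF _ refl] by blast
    have "restrict_type t (fst t - 1) = ball_type G v (fst t - 1)"
      using restrict_ball_type[OF G(1,2), of "fst t - 1" "fst t"] G(3) by simp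
    then have "e = {ball_type G v (fst t - 1), ball_type G v (fst t)}" using t(1) G(3) by simp
    then show "e \<in> ?A" using G(1,2) t(3) by blast
  qed
  then show ?thesis by (simp add: ball_tree_def ball_level_tree.tree_def)
qed

lemma finite_ball: "G \<in> \<G> \<Longrightarrow> v \<in> vertices G \<Longrightarrow> finite (reach G v r)"
  using finite_reach[of G v r] is_graph[of G] lf[of G] by (simp add: is_graph_def)

text \<open>By local finiteness a type is determined by its radius and one finite rooted
  representative on natural numbers, of which there are countably many.\<close>

lemma countable_ball_types: "countable (ball_types \<G>)"
proof -
  let ?h = "\<lambda>(r :: nat, K :: nat sgraph, v :: nat).
    (r, {(K' :: nat sgraph, w :: nat). simple_graph K' \<and> rooted_isomorphic K v K' w})"
  have "ball_types \<G> \<subseteq> ?h ` (UNIV \<times> {K. simple_graph K \<and> finite (vertices K)} \<times> UNIV)"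
  proof
    fix t assume "t \<in> ball_types \<G>"
    then obtain G v r where G: "G \<in> \<G>" "v \<in> vertices G" "t = ball_type G v r" by (auto simp: ball_types_def)
    have "finite (vertices (graph_ball G v r))" "simple_graph (graph_ball G v r)"
      using vertices_graph_ball[OF is_graph[OF G(1)] G(2)] finite_ball[OF G(1,2)]
        simple_graph_ball is_graph[OF G(1)] by (auto simp: is_graph_def)
    then show "t \<in> ?h ` (UNIV \<times> {K. simple_graph K \<and> finite (vertices K)} \<times> UNIV)"
      using G(3) by (intro image_eqI[where x = "(r, graph_ball G v r, v)"]) (simp_all add: ball_type_def)
  qed
  moreover have "countable (?h ` (UNIV \<times> {K. simple_graph K \<and> finite (vertices K)} \<times> UNIV))"
    by (intro countable_image countable_SIGMA countable_finite_simple_graphs countableI_type)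
  ultimately show ?thesis by (rule countable_subset)
qed

text \<open>Isomorphic balls have equal size, so all labelled representatives live on the same
  finite initial segment.\<close>

lemma finite_labelled_balls:
  "finite {graph_ball C 0 r | C. C \<in> \<G> \<and> labelled C \<and> ball_type C 0 r = t}"
proof (cases "\<exists>C. C \<in> \<G> \<and> labelled C \<and> ball_type C 0 r = t")
  case True
  then obtain C where C: "C \<in> \<G>" "labelled C" "ball_type C 0 r = t" by blast
  have C': "is_graph C" "0 \<in> vertices C" "simple_graph C" using C(2) by (auto simp: labelled_def is_graph_def)
  have "{graph_ball C 0 r | C. C \<in> \<G> \<and> labelled C \<and> ball_type C 0 r = t} \<subseteq>
      {K. simple_graph K \<and> vertices K \<subseteq> reach C 0 r}"
  proof
    fix K assume "K \<in> {graph_ball C 0 r | C. C \<in> \<G> \<and> labelled C \<and> ball_type C 0 r = t}"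
    then obtain D where D: "K = graph_ball D 0 r" "labelled D" "ball_type D 0 r = t" by blast
    have D': "is_graph D" "0 \<in> vertices D" "simple_graph D" using D(2) by (auto simp: labelled_def is_graph_def)
    have "ball_type C 0 r = ball_type D 0 r" using C D by simp
    then obtain f where "graph_iso f (graph_ball C 0 r) (graph_ball D 0 r)"
      unfolding ball_type_eq_iff[OF C'(3,2)] rooted_isomorphic_def by blast
    then have "card (reach C 0 r) = card (reach D 0 r)"
      using vertices_graph_ball[OF C'(1,2)] vertices_graph_ball[OF D'(1,2)]
      by (intro bij_betw_same_card[of f]) (simp add: graph_iso_def)
    moreover obtain m n where "reach C 0 r = {..<m}" "reach D 0 r = {..<n}"
      using C(2) D(2) by (meson labelled_def)
    ultimately have "reach C 0 r = reach D 0 r" by simp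
    then show "K \<in> {K. simple_graph K \<and> vertices K \<subseteq> reach C 0 r}"
      using D(1) D'(3) vertices_graph_ball[OF D'(1,2)] simple_graph_ball by simp
  qed
  then show ?thesis
    by (rule finite_subset) (intro finite_simple_graphs finite_ball C(1) C'(2))
next
  case False
  then have no: "{graph_ball C 0 r | C. C \<in> \<G> \<and> labelled C \<and> ball_type C 0 r = t} = {}" by blast
  show ?thesis unfolding no by (rule finite.emptyI)
qed

text \<open>The labelled graphs with all root balls in \<open>S\<close> are glued along common
  balls. Neighbours of a vertex at distance \<open>r\<close> lie in an \<open>(r+1)\<close>-ball
  extending the \<open>r\<close>-ball recorded with it; only finitely many types in
  \<open>S\<close>, with finitely many labelled balls each, are possible, which bounds the
  degree.\<close>

lemma jointly_embeddable_rays: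
  assumes fin: "\<And>t. t \<in> S \<Longrightarrow> finite (S \<inter> ball_level_tree.children t)"
  shows "jointly_embeddable {G \<in> \<G>. \<exists>v\<in>vertices G. \<forall>r. ball_type G v r \<in> S}"
proof -
  define CC where "CC = {C \<in> \<G>. labelled C \<and> (\<forall>r. ball_type C 0 r \<in> S)}"
  have CC: "C \<in> \<G>" "is_graph C" "simple_graph C" "0 \<in> vertices C" if "C \<in> CC" for C
    using that by (auto simp: CC_def labelled_def is_graph_def)
  define d where "d C = graph_dist C 0" for C :: "nat sgraph"
  have d_le: "d C x \<le> r \<longleftrightarrow> x \<in> reach C 0 r" if "C \<in> CC" "x \<in> vertices C" for C x r
    unfolding d_def by (rule graph_dist_le_iff[OF CC(2)[OF that(1)] CC(4)[OF that(1)] that(2)])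
  \<comment> \<open>A vertex is recorded with the smallest labelled ball containing it, so graphs that agree on a
    ball share the vertices of that ball.\<close>
  define emb where "emb C x = (d C x, graph_ball C 0 (d C x), x)" for C x
  have emb_eq: "x = y \<and> d C x = d D y \<and> graph_ball C 0 (d C x) = graph_ball D 0 (d C x)"
    if "emb C x = emb D y" for C D x y using that by (auto simp: emb_def)
  define L where "L = \<lparr>vertices = {emb C x | C x. C \<in> CC \<and> x \<in> vertices C},
    edges = {{emb C x, emb C y} | C x y. C \<in> CC \<and> {x, y} \<in> edges C}\<rparr>"
  have L_edge: "\<exists>C x y. C \<in> CC \<and> {x, y} \<in> edges C \<and> a = emb C x \<and> b = emb C y"
    if "{a, b} \<in> edges L" for a b
  proof -
    obtain C x y where C: "C \<in> CC" "{x, y} \<in> edges C" "{a, b} = {emb C x, emb C y}"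
      using \<open>{a, b} \<in> edges L\<close> by (auto simp: L_def)
    from C(3) consider "a = emb C x" "b = emb C y" | "a = emb C y" "b = emb C x"
      by (auto simp: doubleton_eq_iff)
    then show ?thesis
    proof cases
      case 2
      have "{y, x} \<in> edges C" using C(2) by (simp add: insert_commute)
      then show ?thesis using C(1) 2 by blast
    qed (use C(1,2) in blast)
  qed
  show ?thesis
  proof (rule jointly_embeddableI)
    show "simple_graph L"
      unfolding simple_graph_def
    proof
      fix e assume "e \<in> edges L"
      then obtain C x y where C: "C \<in> CC" "{x, y} \<in> edges C" "e = {emb C x, emb C y}"
        by (auto simp: L_def)
      have "x \<in> vertices C" "y \<in> vertices C" "x \<noteq> y"
        using simple_graph_edgeD[OF CC(3)[OF C(1)] C(2)] by blast+
      moreover from this have "emb C x \<noteq> emb C y" using emb_eq[of C x C y] by blast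
      ultimately show "\<exists>u\<in>vertices L. \<exists>v\<in>vertices L. u \<noteq> v \<and> e = {u, v}"
        using C by (intro bexI[of _ "emb C x"] bexI[of _ "emb C y"]) (auto simp: L_def)
    qed
    have "vertices L \<subseteq> UNIV \<times> {K. simple_graph K \<and> finite (vertices K)} \<times> UNIV"
    proof
      fix w assume "w \<in> vertices L"
      then obtain C x where C: "C \<in> CC" "w = emb C x" by (auto simp: L_def)
      then show "w \<in> UNIV \<times> {K. simple_graph K \<and> finite (vertices K)} \<times> UNIV"
        using CC[OF C(1)] simple_graph_ball finite_ball by (simp add: emb_def vertices_graph_ball)
    qed
    moreover have "countable ((UNIV :: nat set) \<times> {K :: nat sgraph. simple_graph K \<and> finite (vertices K)} \<times> (UNIV :: nat set))"
      by (intro countable_SIGMA countable_finite_simple_graphs countableI_type)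
    ultimately show "countable (vertices L)" by (rule countable_subset)
    show "locally_finite L"
      unfolding locally_finite_def
    proof
      fix w assume "w \<in> vertices L"
      then obtain C x where C: "C \<in> CC" "x \<in> vertices C" "w = emb C x" by (auto simp: L_def)
      define r where "r = d C x"
      \<comment> \<open>All \<open>(r+1)\<close>-balls that continue the \<open>r\<close>-ball
        recorded in \<open>w\<close>.\<close>
      define KK where "KK = {graph_ball D 0 (Suc r) | D. D \<in> CC \<and> graph_ball D 0 r = graph_ball C 0 r}"
      let ?Ch = "S \<inter> ball_level_tree.children (ball_type C 0 r)"
      have "KK \<subseteq> (\<Union>t\<in>?Ch. {graph_ball D 0 (Suc r) | D. D \<in> \<G> \<and> labelled D \<and> ball_type D 0 (Suc r) = t})"
      proof
        fix K assume "K \<in> KK"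
        then obtain D where D: "D \<in> CC" "graph_ball D 0 r = graph_ball C 0 r" "K = graph_ball D 0 (Suc r)"
          unfolding KK_def by blast
        have "restrict_type (ball_type D 0 (Suc r)) r = ball_type C 0 r"
          using restrict_ball_type[OF CC(1,4)[OF D(1)], of r "Suc r"] ball_type_cong[OF D(2)] by simp
        moreover have "ball_type D 0 (Suc r) \<in> ball_types \<G>"
          using CC[OF D(1)] unfolding ball_types_def by blast
        moreover have "ball_type D 0 (Suc r) \<in> S" using D(1) by (simp add: CC_def)
        ultimately have "ball_type D 0 (Suc r) \<in> ?Ch" by (simp add: ball_level_tree.children_def)
        then show "K \<in> (\<Union>t\<in>?Ch. {graph_ball D 0 (Suc r) | D. D \<in> \<G> \<and> labelled D \<and> ball_type D 0 (Suc r) = t})"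
          using D(1,3) unfolding CC_def by blast
      qed
      moreover have "finite ?Ch" using C(1) by (intro fin) (simp add: CC_def)
      then have "finite (\<Union>t\<in>?Ch. {graph_ball D 0 (Suc r) | D. D \<in> \<G> \<and> labelled D \<and> ball_type D 0 (Suc r) = t})"
        by (intro finite_UN_I finite_labelled_balls)
      ultimately have KK: "finite KK" by (rule finite_subset)
      \<comment> \<open>For vertices of such a ball, \<open>emb\<close> depends on the ball only, so
        one graph per ball yields all possible neighbours.\<close>
      define rep where "rep K = (SOME D. D \<in> CC \<and> graph_ball D 0 (Suc r) = K)" for K
      have rep: "rep K \<in> CC \<and> graph_ball (rep K) 0 (Suc r) = K" if "K \<in> KK" for K
        unfolding rep_def by (rule someI_ex) (use that in \<open>auto simp: KK_def\<close>)
      have "neighbours L w \<subseteq> (\<Union>K\<in>KK. emb (rep K) ` vertices K)"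
      proof
        fix z assume "z \<in> neighbours L w"
        then obtain D x' y where D: "D \<in> CC" "{x', y} \<in> edges D" "w = emb D x'" "z = emb D y"
          using L_edge[of w z] by (auto simp: neighbours_def)
        have x': "x' = x" "d D x = r" "graph_ball D 0 r = graph_ball C 0 r"
          using emb_eq[of C x D x'] C(3) D(3) by (auto simp: r_def)
        note V = simple_graph_edgeD[OF CC(3)[OF D(1)] D(2)]
        have "x \<in> reach D 0 r" using d_le[OF D(1) V(1), of r] x' by simp
        then have y: "y \<in> reach D 0 (Suc r)" using D(2) x' by auto
        define K where "K = graph_ball D 0 (Suc r)"
        have "K \<in> KK" using D(1) x' by (auto simp: KK_def K_def)
        note R = rep[OF this]
        have dy: "d D y \<le> Suc r" using d_le[OF D(1) V(2)] y by blast
        have cong: "graph_ball (rep K) 0 q = graph_ball D 0 q" "reach (rep K) 0 q = reach D 0 q"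
          if "q \<le> Suc r" for q
          using graph_ball_cong[OF CC(2,4)[OF R[THEN conjunct1]] CC(2,4)[OF D(1)], of "Suc r" 0 0 q]
            R that by (auto simp: K_def)
        have yV: "y \<in> vertices (rep K)"
          using y cong(2)[OF order_refl] reach_subset_vertices[OF CC(3,4)[OF R[THEN conjunct1]]] by blast
        have "d (rep K) y \<le> q \<longleftrightarrow> d D y \<le> q" if "q \<le> Suc r" for q
          unfolding d_le[OF R[THEN conjunct1] yV] d_le[OF D(1) V(2)] cong(2)[OF that] ..
        from this[OF dy] this[of "d (rep K) y"] dy have "d (rep K) y = d D y" by fastforce
        then have "z = emb (rep K) y" using cong(1)[OF dy] D(4) by (simp add: emb_def)
        moreover have "y \<in> vertices K" using y CC(2,4)[OF D(1)] by (simp only: K_def vertices_graph_ball)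
        ultimately show "z \<in> (\<Union>K\<in>KK. emb (rep K) ` vertices K)" using \<open>K \<in> KK\<close> by blast
      qed
      moreover have "finite (vertices K)" if K: "K \<in> KK" for K
      proof -
        obtain D where D: "D \<in> CC" "K = graph_ball D 0 (Suc r)" using K by (auto simp: KK_def)
        then show ?thesis using finite_ball CC[OF D(1)] by (simp only: vertices_graph_ball)
      qed
      ultimately show "finite (neighbours L w)"
        by (intro finite_subset[of "neighbours L w" "\<Union>K\<in>KK. emb (rep K) ` vertices K"]
            finite_UN_I KK finite_imageI)
    qed
    fix G assume "G \<in> {G \<in> \<G>. \<exists>v\<in>vertices G. \<forall>r. ball_type G v r \<in> S}"
    then obtain v where G: "G \<in> \<G>" "v \<in> vertices G" "\<And>r. ball_type G v r \<in> S" by blast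
    obtain g where g: "relabel g G \<in> \<G>" "labelled (relabel g G)" "inj_on g (vertices G)"
      "\<And>s. ball_type (relabel g G) 0 s = ball_type G v s"
      using ex_labelled[OF G(1,2)] by blast
    define C where "C = relabel g G"
    have C: "C \<in> CC" using g G(3) by (simp add: CC_def C_def)
    have "induced_embedding (emb C) C L"
      unfolding induced_embedding_def
    proof (intro conjI ballI)
      show "inj_on (emb C) (vertices C)" using emb_eq[of C _ C] by (blast intro: inj_onI)
      show "emb C ` vertices C \<subseteq> vertices L" using C by (auto simp: L_def)
      fix x y assume xy: "x \<in> vertices C" "y \<in> vertices C"
      show "{x, y} \<in> edges C \<longleftrightarrow> {emb C x, emb C y} \<in> edges L"
      proof
        assume "{emb C x, emb C y} \<in> edges L"
        then obtain D x' y' where D: "D \<in> CC" "{x', y'} \<in> edges D" "emb C x = emb D x'" "emb C y = emb D y'"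
          using L_edge by blast
        note eqs = emb_eq[OF D(3)] emb_eq[OF D(4)]
        have "x \<in> vertices D" "y \<in> vertices D" using simple_graph_edgeD[OF CC(3)[OF D(1)] D(2)] eqs by auto
        \<comment> \<open>One of the two recorded balls has this radius, so \<open>C\<close> and
          \<open>D\<close> agree on a ball containing both ends and the edge of \<open>D\<close> is
          an edge of \<open>C\<close>. This is why the embedding is induced.\<close>
        define r where "r = max (d C x) (d C y)"
        have "r = d C x \<or> r = d C y" by (auto simp: r_def max_def)
        then have ball: "graph_ball D 0 r = graph_ball C 0 r" using eqs by metis
        have "x \<in> reach D 0 r" "y \<in> reach D 0 r"
          using d_le[OF D(1) \<open>x \<in> vertices D\<close>, of r] d_le[OF D(1) \<open>y \<in> vertices D\<close>, of r] eqs
          by (auto simp: r_def)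
        then have "{x, y} \<in> edges (graph_ball D 0 r)"
          using D(2) eqs unfolding edges_graph_ball[OF CC(2,4)[OF D(1)]] by blast
        then show "{x, y} \<in> edges C" unfolding ball edges_graph_ball[OF CC(2,4)[OF C]] by blast
      qed (use C in \<open>auto simp: L_def\<close>)
    qed
    moreover have "induced_embedding g G C"
      unfolding C_def using is_graph[OF G(1)] g(3) by (intro induced_embedding_relabel) (auto simp: is_graph_def)
    ultimately show "\<exists>f. induced_embedding f G L" using induced_embedding_comp by blast
  qed
qed

lemma not_branching_imp_jointly_embeddable:
  assumes no: "\<And>U. \<not> ball_level_tree.branching U"
  shows "jointly_embeddable \<G>"
proof (rule ccontr)
  assume not: "\<not> jointly_embeddable \<G>"
  let ?N = "ball_types \<G>"
  define W where "W u = {G \<in> \<G>. \<exists>v\<in>vertices G. ball_type G v (fst u) = u}" for u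
  define bad where "bad u \<longleftrightarrow> u \<in> ?N \<and> \<not> jointly_embeddable (W u)" for u
  have step: "\<exists>w. ball_level_tree.leq u w \<and> infinite {c \<in> ball_level_tree.children w. bad c}"
    if u: "bad u" for u
  proof (rule ccontr)
    assume "\<nexists>w. ball_level_tree.leq u w \<and> infinite {c \<in> ball_level_tree.children w. bad c}"
    then have fin: "finite {c \<in> ball_level_tree.children w. bad c}" if "ball_level_tree.leq u w" for w
      using that by blast
    have uN: "u \<in> ?N" using u by (simp add: bad_def)
    \<comment> \<open>The path from the root to \<open>u\<close> together with the bad descendants
      of \<open>u\<close>: a proper ancestor of \<open>u\<close> has one child in \<open>S\<close>,
      any other element finitely many.\<close>
    define S where "S = {t. ball_level_tree.leq t u \<or> ball_level_tree.leq u t \<and> bad t}"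
    have "finite (S \<inter> ball_level_tree.children t)" if t: "t \<in> S" for t
    proof (cases "fst t < fst u")
      case True
      have "c = restrict_type u (Suc (fst t))" if "c \<in> S \<inter> ball_level_tree.children t" for c
      proof -
        have "fst c = Suc (fst t)" using that ball_level_tree.ht_children by blast
        moreover have "ball_level_tree.leq c u"
        proof (rule ccontr)
          assume "\<not> ball_level_tree.leq c u"
          then have c: "ball_level_tree.leq u c" using that by (simp add: S_def)
          then have "fst u = fst c" "c \<in> ball_types \<G>"
            using True \<open>fst c = Suc (fst t)\<close> by (simp_all add: ball_level_tree.leq_def)
          then have "u = c" using ball_level_tree.leq_unique[OF c ball_level_tree.leq_refl] by simp
          then show False using c \<open>\<not> ball_level_tree.leq c u\<close> by simp
        qed
        ultimately show ?thesis by (simp add: ball_level_tree.leq_def)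
      qed
      then have "S \<inter> ball_level_tree.children t \<subseteq> {restrict_type u (Suc (fst t))}" by blast
      then show ?thesis by (rule finite_subset) simp
    next
      case False
      then have "ball_level_tree.leq u t"
        using t uN by (auto simp: S_def ball_level_tree.leq_def ball_level_tree.anc_self)
      moreover have "S \<inter> ball_level_tree.children t \<subseteq> {c \<in> ball_level_tree.children t. bad c}"
        using False ball_level_tree.ht_children by (fastforce simp: S_def ball_level_tree.leq_def)
      ultimately show ?thesis using fin finite_subset by blast
    qed
    then have rays: "jointly_embeddable {G \<in> \<G>. \<exists>v\<in>vertices G. \<forall>r. ball_type G v r \<in> S}"
      by (rule jointly_embeddable_rays)
    \<comment> \<open>A countable cover of \<open>W u\<close>: a graph in \<open>W u\<close> either
      has a good ball about the chosen centre, or all its balls about that centre lie in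
      \<open>S\<close>.\<close>
    define F where "F = insert {G \<in> \<G>. \<exists>v\<in>vertices G. \<forall>r. ball_type G v r \<in> S}
      (W ` {c \<in> ?N. jointly_embeddable (W c)})"
    have "countable F"
      unfolding F_def using countable_ball_types
      by (intro countable_insert countable_image) (auto intro: countable_subset)
    then have "jointly_embeddable (\<Union>F)"
      by (rule jointly_embeddable_Union) (use rays in \<open>auto simp: F_def\<close>)
    moreover have "W u \<subseteq> \<Union>F"
    proof
      fix G assume "G \<in> W u"
      then obtain v where G: "G \<in> \<G>" "v \<in> vertices G" "ball_type G v (fst u) = u" by (auto simp: W_def)
      have N: "ball_type G v r \<in> ?N" for r using G by (auto simp: ball_types_def)
      show "G \<in> \<Union>F"
      proof (cases "\<exists>r. jointly_embeddable (W (ball_type G v r))")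
        case True
        then obtain r where r: "jointly_embeddable (W (ball_type G v r))" by blast
        have "G \<in> W (ball_type G v r)" using G by (auto simp: W_def)
        moreover have "W (ball_type G v r) \<in> F" using r N[of r] by (simp add: F_def)
        ultimately show ?thesis by blast
      next
        case False
        have "ball_type G v r \<in> S" for r
        proof (cases "r \<le> fst u")
          case True
          then have "restrict_type u r = ball_type G v r"
            using restrict_ball_type[OF G(1,2), of r "fst u"] G(3) by simp
          then show ?thesis using N[of r] uN True by (simp add: S_def ball_level_tree.leq_def)
        next
          case r: False
          then have "restrict_type (ball_type G v r) (fst u) = u"
            using restrict_ball_type[OF G(1,2), of "fst u" r] G(3) by simp
          then show ?thesis using N[of r] uN r False by (simp add: S_def ball_level_tree.leq_def bad_def)
        qed
        then have "G \<in> {G \<in> \<G>. \<exists>v\<in>vertices G. \<forall>r. ball_type G v r \<in> S}" using G by blast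
        then show ?thesis unfolding F_def by blast
      qed
    qed
    ultimately show False using u jointly_embeddable_mono by (auto simp: bad_def)
  qed
  define U where "U = {w \<in> ?N. infinite {c \<in> ball_level_tree.children w. bad c}}"
  have bad_U: "\<exists>w\<in>U. ball_level_tree.leq c w" if "bad c" for c
    using step[OF that] by (auto simp: U_def ball_level_tree.leq_def)
  \<comment> \<open>The empty set embeds into the empty graph, so the class has a member and thus a
    ball of radius 0 to start from.\<close>
  have "jointly_embeddable {}" by (rule jointly_embeddableI[of "\<lparr>vertices = {}, edges = {}\<rparr> :: nat sgraph"])
    (auto simp: simple_graph_def locally_finite_def)
  then have "\<G> \<noteq> {}" using not by auto
  then obtain G v where G: "G \<in> \<G>" "v \<in> vertices G"
    using is_graph by (fastforce simp: is_graph_def graph_connected_def)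
  have "W (ball_type G v 0) = \<G>"
  proof -
    have "\<exists>v'\<in>vertices G'. ball_type G' v' 0 = ball_type G v 0" if G': "G' \<in> \<G>" for G'
    proof -
      obtain v' where "v' \<in> vertices G'"
        using is_graph[OF G'] by (auto simp: is_graph_def graph_connected_def)
      then show ?thesis using ball_type_0[OF is_graph[OF G'] _ is_graph[OF G(1)] G(2)] by blast
    qed
    then show ?thesis by (auto simp: W_def)
  qed
  then have "bad (ball_type G v 0)" using not G by (auto simp: bad_def ball_types_def)
  then have "U \<noteq> {}" using bad_U by blast
  moreover have "infinite {c \<in> ball_level_tree.children w. \<exists>w'\<in>U. ball_level_tree.leq c w'}" if "w \<in> U" for w
  proof -
    have "{c \<in> ball_level_tree.children w. bad c} \<subseteq>
        {c \<in> ball_level_tree.children w. \<exists>w'\<in>U. ball_level_tree.leq c w'}" using bad_U by blast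
    moreover have "infinite {c \<in> ball_level_tree.children w. bad c}" using that by (simp add: U_def)
    ultimately show ?thesis by (rule infinite_super)
  qed
  ultimately have "ball_level_tree.branching U"
    unfolding ball_level_tree.branching_def by (auto simp: U_def)
  then show False using no by blast
qed

end

section \<open>Branching excludes a locally finite host\<close>

definition rooted_monomorphism :: "('a \<Rightarrow> 'b) \<Rightarrow> 'a sgraph \<Rightarrow> 'a \<Rightarrow> 'b sgraph \<Rightarrow> 'b \<Rightarrow> bool" where
  "rooted_monomorphism f G v H h \<longleftrightarrow> inj_on f (vertices G) \<and> f ` vertices G \<subseteq> vertices H \<and>
    (\<forall>x y. {x, y} \<in> edges G \<longrightarrow> {f x, f y} \<in> edges H) \<and> f v = h"

text \<open>The image of the ball of radius \<open>r\<close> is a graph on vertices of the finite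
  \<open>r\<close>-ball about \<open>h\<close>, not necessarily induced in \<open>H\<close>. There
  are finitely many such images, and each determines the type.\<close>

lemma finite_monomorphic_ball_types:
  fixes H :: "nat sgraph"
  assumes H: "simple_graph H" "locally_finite H" "h \<in> vertices H"
  shows "finite {ball_type G v r | G v. is_graph G \<and> v \<in> vertices G \<and> (\<exists>f. rooted_monomorphism f G v H h)}"
    (is "finite ?A")
proof -
  let ?h = "\<lambda>K :: nat sgraph. (r, {(K' :: nat sgraph, w :: nat). simple_graph K' \<and> rooted_isomorphic K h K' w})"
  have "?A \<subseteq> ?h ` {K. simple_graph K \<and> vertices K \<subseteq> reach H h r}"
  proof
    fix t assume "t \<in> ?A"
    then obtain G v f where G: "is_graph G" "v \<in> vertices G" "t = ball_type G v r"
      and f: "rooted_monomorphism f G v H h" by blast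
    let ?B = "graph_ball G v r"
    have sB: "simple_graph ?B" using G by (auto simp: is_graph_def intro: simple_graph_ball)
    have VB: "vertices ?B = reach G v r" by (rule vertices_graph_ball[OF G(1,2)])
    have sub: "reach G v r \<subseteq> vertices G"
      using G reach_subset_vertices[of G v r] by (simp add: is_graph_def)
    then have inj: "inj_on f (vertices ?B)"
      using f inj_on_subset[OF _ sub, of f] by (simp add: rooted_monomorphism_def VB)
    have iso: "rooted_isomorphic ?B v (relabel f ?B) h"
      using graph_iso_relabel[OF sB inj] f root_in_reach[of v G r] VB
      by (auto simp: rooted_isomorphic_def rooted_monomorphism_def relabel_def)
    then have "rooted_isomorphic ?B v K' w \<longleftrightarrow> rooted_isomorphic (relabel f ?B) h K' w" for K' :: "nat sgraph" and w
      using rooted_isomorphic_trans[OF rooted_isomorphic_sym[OF iso], of K' w]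
        rooted_isomorphic_trans[OF iso, of K' w] by blast
    then have "t = ?h (relabel f ?B)" using G(3) by (simp add: ball_type_def)
    moreover have "simple_graph (relabel f ?B)" by (rule simple_graph_relabel[OF sB inj])
    moreover have "f ` reach G v r \<subseteq> reach H (f v) r"
      by (rule reach_image_subset[OF _ order_refl]) (use f in \<open>auto simp: rooted_monomorphism_def\<close>)
    then have "vertices (relabel f ?B) \<subseteq> reach H h r"
      using f VB by (simp add: relabel_def rooted_monomorphism_def)
    ultimately show "t \<in> ?h ` {K. simple_graph K \<and> vertices K \<subseteq> reach H h r}" by blast
  qed
  then show ?thesis
    by (rule finite_subset[OF _ finite_imageI[OF finite_simple_graphs[OF finite_reach[OF H]]]])
qed

context closed_locally_finite_class
begin

lemma branching_imp_no_host:
  fixes H :: "nat sgraph"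
  assumes U: "ball_level_tree.branching U"
    and H: "is_graph H" "locally_finite H" "contains H \<G>"
  shows False
proof -
  have sH: "simple_graph H" "vertices H \<noteq> {}" "countable (vertices H)"
    using H by (auto simp: is_graph_def graph_connected_def)
  \<comment> \<open>An enumeration of all vertices of \<open>H\<close>, with repetitions if
    \<open>H\<close> is finite.\<close>
  define h where "h = from_nat_into (vertices H)"
  \<comment> \<open>Formulated with maps of whole graphs, so that it applies directly to the limit
    of the ray.\<close>
  define fits where "fits n r = {ball_type G v r | G v. is_graph G \<and> v \<in> vertices G \<and>
    (\<exists>f. rooted_monomorphism f G v H (h n))}" for n r
  have fits: "finite (fits n r)" for n r
    unfolding fits_def h_def
    by (rule finite_monomorphic_ball_types[OF sH(1) H(2) from_nat_into[OF sH(2)]])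
  have "\<exists>u. \<forall>n. u n \<in> U \<and> (\<exists>c\<in>ball_level_tree.children (u n).
    ball_level_tree.leq c (u (Suc n)) \<and> c \<notin> fits n (fst c))"
  proof (rule dependent_nat_choice)
    show "\<exists>u. u \<in> U" using U by (auto simp: ball_level_tree.branching_def)
    fix u n assume "u \<in> U"
    then have "infinite {c \<in> ball_level_tree.children u. \<exists>w\<in>U. ball_level_tree.leq c w}"
      using U by (simp add: ball_level_tree.branching_def)
    then have "infinite ({c \<in> ball_level_tree.children u. \<exists>w\<in>U. ball_level_tree.leq c w} - fits n (Suc (fst u)))"
      using fits by (rule Diff_infinite_finite[rotated])
    from infinite_imp_nonempty[OF this] obtain c where c: "c \<in> ball_level_tree.children u"
        "\<exists>w\<in>U. ball_level_tree.leq c w" "c \<notin> fits n (Suc (fst u))"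
      by blast
    have "c \<notin> fits n (fst c)" using c(3) ball_level_tree.ht_children[OF c(1)] by simp
    then show "\<exists>w. w \<in> U \<and> (\<exists>c\<in>ball_level_tree.children u. ball_level_tree.leq c w \<and> c \<notin> fits n (fst c))"
      using c(1,2) by blast
  qed
  then obtain u c where u: "\<And>n. u n \<in> U" and c: "\<And>n. c n \<in> ball_level_tree.children (u n)"
    "\<And>n. ball_level_tree.leq (c n) (u (Suc n))" "\<And>n. c n \<notin> fits n (fst (c n))" by metis
  have uN: "u n \<in> ball_types \<G>" for n using u U by (auto simp: ball_level_tree.branching_def)
  have step: "ball_level_tree.leq (u n) (u (Suc n))" for n
    by (rule ball_level_tree.leq_trans[OF ball_level_tree.children_leq[OF c(1)] c(2)])
  have chain: "ball_level_tree.leq (u n) (u m)" if "n \<le> m" for n m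
    using that
  proof (induction rule: dec_induct)
    case base
    then show ?case by (rule ball_level_tree.leq_refl[OF uN])
  next
    case (step k)
    then show ?case using ball_level_tree.leq_trans \<open>\<And>n. ball_level_tree.leq (u n) (u (Suc n))\<close> by blast
  qed
  have ht: "n \<le> fst (u n)" for n
  proof (induction n)
    case (Suc n)
    have "fst (u n) < fst (u (Suc n))"
      using ball_level_tree.ht_children[OF c(1)[of n]] c(2)[of n] by (simp add: ball_level_tree.leq_def)
    then show ?case using Suc by simp
  qed simp
  \<comment> \<open>The ray through the \<open>u n\<close>; the element \<open>u r\<close> has
    height at least \<open>r\<close>, so it has an ancestor at level \<open>r\<close>.\<close>
  define t where "t r = restrict_type (u r) r" for r
  have t_eq: "restrict_type (u n) r = t r" if r: "r \<le> fst (u n)" for n r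
  proof -
    \<comment> \<open>Both \<open>u n\<close> and \<open>u r\<close> are ancestors of
      \<open>u (max n r)\<close>, so they have the same ancestor at level \<open>r\<close>.\<close>
    have "restrict_type (u (max n r)) r = restrict_type (u i) r" if "i \<le> max n r" "r \<le> fst (u i)" for i
      using chain[OF that(1)] that(2) ball_level_tree.anc_anc[OF uN, of r "fst (u i)" "max n r"]
      by (simp add: ball_level_tree.leq_def)
    from this[of n] this[of r] show ?thesis using r ht[of r] by (simp add: t_def)
  qed
  have tN: "t r \<in> ball_types \<G>" for r
    unfolding t_def by (rule ball_level_tree.anc_in[OF uN ht])
  have ht_t: "fst (t r) = r" for r unfolding t_def by (rule ball_level_tree.ht_anc[OF uN ht])
  have t_Suc: "restrict_type (t (Suc r)) r = t r" for r
    using ball_level_tree.anc_anc[OF uN, of r "Suc r" "Suc r"] ht[of "Suc r"] t_eq[of r "Suc r"]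
    by (simp add: t_def)
  obtain G v where G: "G \<in> \<G>" "v \<in> vertices G" "\<And>r. ball_type G v r = t r"
    using ray_limit[OF tN ht_t t_Suc] by blast
  obtain K f where K: "is_subgraph K H" "graph_iso f G K"
    using H(3) G(1) unfolding contains_def isomorphic_def by blast
  have "rooted_monomorphism f G v H (f v)"
    unfolding rooted_monomorphism_def
  proof (intro conjI allI impI)
    show "inj_on f (vertices G)" using K(2) by (simp add: graph_iso_def bij_betw_def)
    show "f ` vertices G \<subseteq> vertices H" using K by (simp add: graph_iso_def bij_betw_def is_subgraph_def)
    fix x y assume e: "{x, y} \<in> edges G"
    have "x \<in> vertices G" "y \<in> vertices G"
      using simple_graph_edgeD[OF _ e] is_graph[OF G(1)] by (auto simp: is_graph_def)
    then show "{f x, f y} \<in> edges H" using e K by (auto simp: graph_iso_def is_subgraph_def)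
  qed simp
  moreover have "f v \<in> vertices H" using K G(2) by (auto simp: graph_iso_def bij_betw_def is_subgraph_def)
  then obtain n where "f v = h n" unfolding h_def using from_nat_into_surj[OF sH(3)] by metis
  \<comment> \<open>The diagonal step: \<open>n\<close> is an index of the image of the centre
    \<open>v\<close>, yet the ball \<open>c n\<close> of the ray was chosen not to fit at
    \<open>h n\<close>.\<close>
  ultimately have "ball_type G v r \<in> fits n r" for r
    unfolding fits_def using is_graph[OF G(1)] G(2) by auto
  moreover have "c n = t (fst (c n))"
    using t_eq[of "fst (c n)" "Suc n"] c(2)[of n] by (simp add: ball_level_tree.leq_def)
  ultimately show False using c(3)[of n] G(3) by metis
qed

end

theorem theorem1p1:
  fixes \<G> :: "nat sgraph set"
  assumes "graph_class \<G>"
    and "\<forall>G\<in>\<G>. locally_finite G"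
    and "closed_class \<G>"
  shows "((\<exists>H :: nat sgraph. is_graph H \<and> locally_finite H \<and> strongly_contains H \<G>) \<longleftrightarrow>
          (\<exists>H :: nat sgraph. is_graph H \<and> locally_finite H \<and> contains H \<G>)) \<and>
         ((\<exists>H :: nat sgraph. is_graph H \<and> locally_finite H \<and> contains H \<G>) \<longleftrightarrow>
          \<not> (\<exists>T :: nat sgraph. is_T_infinity T \<and> contains_subdivision (ball_tree \<G>) T))"
    (is "(?strong \<longleftrightarrow> ?weak) \<and> (_ \<longleftrightarrow> \<not> ?sub)")
proof -
  interpret closed_locally_finite_class \<G> by unfold_locales (use assms in auto)
  have "?weak" if "?strong"
  proof -
    from that obtain H :: "nat sgraph" where H: "is_graph H" "locally_finite H" "strongly_contains H \<G>" by blast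
    have "is_subgraph (induced_on H S) H" if "S \<subseteq> vertices H" for S
      using H(1) that by (fastforce simp: is_subgraph_def induced_on_def is_graph_def simple_graph_def)
    then have "contains H \<G>" using H(3) unfolding contains_def strongly_contains_def by blast
    then show ?thesis using H by blast
  qed
  moreover have "\<not> ?sub" if "?weak"
    using that branching_imp_no_host ball_level_tree.subdivision_imp_branching ball_tree_eq by metis
  moreover have "?strong" if "\<not> ?sub"
    using that ball_level_tree.branching_imp_subdivision not_branching_imp_jointly_embeddable
      jointly_embeddable_imp_connected_host ball_tree_eq by metis
  ultimately show ?thesis by blast
qed

end
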